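(* Let $P$ be a probability measure on $\mathbb S_{++}^d$ supported on covariance matrices whose eigenvalues lie in the range $[\lambda_{\min},\lambda_{\max}]$, where $0<\lambda_{\min}\le\lambda_{\max}<\infty$, and let $\kappa=\lambda_{\max}/\lambda_{\min}$. Let $\Sigma^\star$ be the Bures--Wasserstein barycenter of $P$, and let the initialization satisfy $\Sigma_0\in\operatorname{supp}P$. 1. (GD) Let $\Sigma_T^{\rm GD}$ denote the $T$-th iterate of Riemannian gradient descent for the barycenter functional $F$, started at $\Sigma_0$, with step size $\eta=\frac{1}{2\kappa}$. Then $$\frac{1}{2\sqrt\kappa}\,W_2^2(\Sigma_T^{\rm GD},\Sigma^\star)\le F(\Sigma_T^{\rm GD})-F(\Sigma^\star)\le\exp\Bigl(-\frac{3T}{64\kappa^{5/2}}\Bigr)\,\{F(\Sigma_0)-F(\Sigma^\star)\}.$$ 2. (SGD) Let $\Sigma_T^{\rm SGD}$ denote the $T$-th iterate ($T\ge1$) of Riemannian stochastic gradient descent started at $\Sigma_0$. Then there is a choice of step sizes $(\eta_t)_{t=1}^T$ for which $$\frac{1}{2\sqrt\kappa}\,\mathbb E\,W_2^2(\Sigma_T^{\rm SGD},\Sigma^\star)\le\mathbb E F(\Sigma_T^{\rm SGD})-F(\Sigma^\star)\le\frac{48\kappa^3\operatorname{var}P}{T}.$$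
   Context: $\mathbb S_{++}^d$ is the set of real symmetric positive definite $d\times d$ matrices. For $\Sigma,\Sigma'\in\mathbb S_{++}^d$, $W_2(\Sigma,\Sigma')$ is the $2$-Wasserstein distance between $\mathcal N(0,\Sigma)$ and $\mathcal N(0,\Sigma')$: $W_2^2(\Sigma,\Sigma')=\operatorname{tr}[\Sigma+\Sigma'-2(\Sigma^{1/2}\Sigma'\Sigma^{1/2})^{1/2}]$. The matrix geometric mean is $\mathrm{GM}(A,B)=A^{1/2}(A^{-1/2}BA^{-1/2})^{1/2}A^{1/2}$. The barycenter functional is $F(\Sigma)=\frac12\int W_2^2(\Sigma,\Sigma')\,dP(\Sigma')$; the barycenter $\Sigma^\star$ is its minimizer over $\mathbb S_{++}^d$; $\operatorname{var}P=2F(\Sigma^\star)$. Riemannian gradient descent with step size $\eta$: for $t\ge1$, $\Sigma_t=S_t\Sigma_{t-1}S_t$ with $S_t=(1-\eta)I_d+\eta\int\mathrm{GM}(\Sigma_{t-1}^{-1},\Sigma)\,dP(\Sigma)$. Riemannian stochastic gradient descent with step sizes $(\eta_t)_{t=1}^T$: given i.i.d. samples $K_1,\dots,K_T$ from $P$, for $t=1,\dots,T$, $\Sigma_t=\hat S_t\Sigma_{t-1}\hat S_t$ with $\hat S_t=(1-\eta_t)I_d+\eta_t\,\mathrm{GM}(\Sigma_{t-1}^{-1},K_t)$. *)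

theory Defs
  imports "HOL-Probability.Probability"
begin

section \<open>Matrices\<close>

definition psd :: "real^'d^'d \<Rightarrow> bool" where
  "psd A \<longleftrightarrow> transpose A = A \<and> (\<forall>x. 0 \<le> x \<bullet> (A *v x))"

definition spd_matrices :: "(real^'d^'d) set" where
  "spd_matrices = {A. transpose A = A \<and> (\<forall>x. x \<noteq> 0 \<longrightarrow> 0 < x \<bullet> (A *v x))}"

definition is_eigenvalue :: "real^'d^'d \<Rightarrow> real \<Rightarrow> bool" where
  "is_eigenvalue A l \<longleftrightarrow> (\<exists>v. v \<noteq> 0 \<and> A *v v = l *\<^sub>R v)"

text \<open>The positive semidefinite square root; meaningful for positive semidefinite arguments,
  where it exists and is unique.\<close>

definition msqrt :: "real^'d^'d \<Rightarrow> real^'d^'d" where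
  "msqrt A = (THE B. psd B \<and> B ** B = A)"

definition geometric_mean :: "real^'d^'d \<Rightarrow> real^'d^'d \<Rightarrow> real^'d^'d" where
  "geometric_mean A B =
     msqrt A ** msqrt (matrix_inv (msqrt A) ** B ** matrix_inv (msqrt A)) ** msqrt A"

section \<open>Bures--Wasserstein barycenters\<close>

text \<open>Squared 2-Wasserstein distance between the centered Gaussians with covariance matrices
  \<open>A\<close> and \<open>B\<close>, in its closed form.\<close>

definition W2_sq :: "real^'d^'d \<Rightarrow> real^'d^'d \<Rightarrow> real" where
  "W2_sq A B = trace (A + B - 2 *\<^sub>R msqrt (msqrt A ** B ** msqrt A))"

definition barycenter_functional :: "(real^'d^'d) measure \<Rightarrow> real^'d^'d \<Rightarrow> real" where
  "barycenter_functional P A = 1 / 2 * (\<integral>B. W2_sq A B \<partial>P)"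

definition is_barycenter :: "(real^'d^'d) measure \<Rightarrow> real^'d^'d \<Rightarrow> bool" where
  "is_barycenter P A \<longleftrightarrow> is_arg_min (barycenter_functional P) (\<lambda>B. B \<in> spd_matrices) A"

text \<open>The variance does not depend on which minimizer \<open>arg_min\<close> selects.\<close>

definition bw_variance :: "(real^'d^'d) measure \<Rightarrow> real" where
  "bw_variance P =
     2 * barycenter_functional P (arg_min (barycenter_functional P) (\<lambda>B. B \<in> spd_matrices))"

section \<open>Probability measures on the positive definite matrices\<close>

definition spd_prob :: "(real^'d^'d) measure \<Rightarrow> bool" where
  "spd_prob P \<longleftrightarrow> prob_space P \<and> sets P = sets (restrict_space borel spd_matrices)"

definition measure_support :: "('a::topological_space) measure \<Rightarrow> 'a set" where
  "measure_support P =
     {x \<in> space P. \<forall>U. open U \<and> x \<in> U \<longrightarrow> 0 < emeasure P (U \<inter> space P)}"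

definition iid_samples :: "'w measure \<Rightarrow> 'a measure \<Rightarrow> nat set \<Rightarrow> (nat \<Rightarrow> 'w \<Rightarrow> 'a) \<Rightarrow> bool" where
  "iid_samples M P I K \<longleftrightarrow>
     prob_space M \<and> prob_space.indep_vars M (\<lambda>_. P) K I \<and> (\<forall>t\<in>I. distr M P (K t) = P)"

section \<open>Riemannian gradient descent and its stochastic variant\<close>

definition gd_step :: "(real^'d^'d) measure \<Rightarrow> real \<Rightarrow> real^'d^'d \<Rightarrow> real^'d^'d" where
  "gd_step P \<eta> A =
     (let S = (1 - \<eta>) *\<^sub>R mat 1 + \<eta> *\<^sub>R (\<integral>B. geometric_mean (matrix_inv A) B \<partial>P)
      in S ** A ** S)"

primrec gd_iterate :: "(real^'d^'d) measure \<Rightarrow> real \<Rightarrow> real^'d^'d \<Rightarrow> nat \<Rightarrow> real^'d^'d" where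
  "gd_iterate P \<eta> A0 0 = A0"
| "gd_iterate P \<eta> A0 (Suc t) = gd_step P \<eta> (gd_iterate P \<eta> A0 t)"

definition sgd_step :: "real \<Rightarrow> real^'d^'d \<Rightarrow> real^'d^'d \<Rightarrow> real^'d^'d" where
  "sgd_step \<eta> K A =
     (let S = (1 - \<eta>) *\<^sub>R mat 1 + \<eta> *\<^sub>R geometric_mean (matrix_inv A) K
      in S ** A ** S)"

text \<open>Step sizes and samples are indexed from 1; their values at 0 are never used.\<close>

primrec sgd_iterate ::
  "(nat \<Rightarrow> real) \<Rightarrow> (nat \<Rightarrow> real^'d^'d) \<Rightarrow> real^'d^'d \<Rightarrow> nat \<Rightarrow> real^'d^'d" where
  "sgd_iterate \<eta> K A0 0 = A0"
| "sgd_iterate \<eta> K A0 (Suc t) = sgd_step (\<eta> (Suc t)) (K (Suc t)) (sgd_iterate \<eta> K A0 t)"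

end

theory Submission
  imports Defs
begin

text \<open>The proof treats a matrix \<open>T = transport A B\<close> as the linear optimal transport map from
  \<open>N(0, A)\<close> to \<open>N(0, B)\<close>: it is the only positive semidefinite solution of \<open>T ** A ** T = B\<close>, and
  \<open>W2_sq A B\<close> is the square of the distance of \<open>T\<close> from the identity in the inner product
  \<open>X \<bullet> (Y ** A)\<close>, where \<open>\<bullet>\<close> is the Frobenius inner product.  In these terms the Riemannian gradient
  of the barycenter functional \<open>F\<close> at \<open>A\<close> is \<open>mat 1 - mean_transport A\<close>, and \<open>grad_sq A\<close> is its
  squared norm.

  Three facts carry the convergence proof.

  \<^item> Couplings bound \<open>W2_sq\<close> from above (\<open>W2_sq_le_coupling\<close>).  Composing the optimal maps with a
    step \<open>S\<close> gives a quadratic upper bound for \<open>F (S ** A ** S)\<close> (\<open>F_step_le\<close>), which plays the role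
    of smoothness with constant one.

  \<^item> Kantorovich duality bounds \<open>W2_sq\<close> from below (\<open>W2_sq_duality\<close>).  The dual potential of \<open>(A', B)\<close>
    is the quadratic form of \<open>transport A' B\<close>; it is strongly convex with constant \<open>1 / sqrt \<kappa>\<close> when
    the spectra lie in \<open>[lmin, lmax]\<close>, and the strong convexity gains a multiple of \<open>W2_sq A A'\<close>.
    Based at the barycenter, where the gradient vanishes, this is the variance inequality; based at
    an iterate, it yields the gradient domination \<open>F_gradient_domination\<close>.

  \<^item> A step of size at most \<open>1 / 2\<close> preserves both spectral bounds (\<open>step_eig_le\<close>, \<open>step_eig_ge\<close>), so
    the constants above are the same at all iterates.  The upper bound is convexity of a quadratic
    form; the lower bound is a Cauchy--Schwarz argument.

  Gradient descent then contracts the gap \<open>F A - F \<Sigma>star\<close> by a fixed factor.  For the stochastic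
  iterates, the expected gap satisfies
  \<open>a' \<le> (1 - 2 * \<eta> / \<kappa> powr (3 / 2) + \<eta>\<^sup>2) * a + \<eta>\<^sup>2 * F \<Sigma>star\<close>.  A first step of size one replaces the
  initialization by a sample, for which the expected gap is at most \<open>F \<Sigma>star\<close>, that is half the
  variance; this is why the final bound does not depend on \<open>F \<Sigma>0\<close>.  Step sizes of order \<open>1 / t\<close> solve
  the recursion from there.\<close>

section \<open>Matrix algebra and the Frobenius inner product\<close>

lemma matrix_mul_diff_left: "(A - B) ** C = A ** C - B ** (C :: real^'n^'m)"
  by (simp add: matrix_matrix_mult_def vec_eq_iff left_diff_distrib sum_subtractf)

lemma matrix_mul_diff_right: "C ** (A - B) = C ** A - C ** (B :: real^'n^'m)"
  by (simp add: matrix_matrix_mult_def vec_eq_iff right_diff_distrib sum_subtractf)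

lemma matrix_mul_scaleR_left: "(c *\<^sub>R A) ** B = c *\<^sub>R (A ** (B :: real^'n^'m))"
  by (simp add: matrix_matrix_mult_def vec_eq_iff sum_distrib_left mult.assoc)

lemma matrix_mul_scaleR_right: "A ** (c *\<^sub>R B) = c *\<^sub>R (A ** (B :: real^'n^'m))"
  by (simp add: matrix_matrix_mult_def vec_eq_iff sum_distrib_left mult_ac)

lemma matrix_mul_add_left: "(A + B) ** C = A ** C + B ** (C :: real^'n^'m)"
  by (simp add: matrix_matrix_mult_def vec_eq_iff distrib_right sum.distrib)

lemmas matrix_distribs =
  matrix_mul_diff_left matrix_mul_diff_right matrix_mul_scaleR_left matrix_mul_scaleR_right
  matrix_mul_add_left matrix_add_ldistrib

lemma transpose_add: "transpose (A + B) = transpose A + transpose (B :: real^'n^'m)"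
  by (simp add: transpose_def vec_eq_iff)

lemma transpose_diff: "transpose (A - B) = transpose A - transpose (B :: real^'n^'m)"
  by (simp add: transpose_def vec_eq_iff)

lemmas transpose_distribs = transpose_add transpose_diff transpose_scalar matrix_transpose_mul

lemma inner_matrix_eq_trace: "X \<bullet> Y = trace (transpose X ** (Y :: real^'n^'m))"
  by (simp add: inner_vec_def trace_def matrix_matrix_mult_def transpose_def) (rule sum.swap)

lemma trace_eq_inner: "trace (X :: real^'n^'n) = mat 1 \<bullet> X"
  by (simp add: inner_matrix_eq_trace)

lemma inner_transpose: "transpose X \<bullet> transpose Y = X \<bullet> (Y :: real^'n^'m)"
  unfolding inner_vec_def transpose_def by simp (rule sum.swap)

lemma inner_matrix_mul_left: "(A ** X) \<bullet> Y = X \<bullet> (transpose A ** (Y :: real^'n^'m))"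
  by (simp add: inner_matrix_eq_trace matrix_transpose_mul matrix_mul_assoc)

lemma inner_matrix_mul_right: "(X ** A) \<bullet> Y = X \<bullet> (Y ** transpose (A :: real^'n^'m))"
  unfolding inner_matrix_eq_trace matrix_transpose_mul
  by (metis matrix_mul_assoc trace_mul_sym)

lemma dot_matrix_vector_transpose: "x \<bullet> (A *v y) = (transpose A *v x) \<bullet> (y :: real^'n)"
  by (simp add: dot_lmul_matrix)

lemma sym_dot: "transpose A = A \<Longrightarrow> x \<bullet> (A *v y) = (A *v x) \<bullet> (y :: real^'n)"
  by (metis dot_matrix_vector_transpose)

text \<open>Pairing with a rank-one matrix makes quadratic forms linear functionals of the matrix, so that
  they commute with integrals and define closed conditions.\<close>

definition outer :: "real^'m \<Rightarrow> real^'n \<Rightarrow> real^'n^'m" where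
  "outer x y = (\<chi> i j. x $ i * y $ j)"

lemma inner_outer: "A \<bullet> outer x y = x \<bullet> (A *v y)"
  by (simp add: inner_vec_def outer_def matrix_vector_mult_def sum_distrib_left mult_ac)

lemma symmetric_eq_zero:
  fixes A :: "real^'n^'n"
  assumes "transpose A = A" "\<And>x. x \<bullet> (A *v x) = 0"
  shows "A = 0"
proof -
  have "A *v x = 0" for x
  proof -
    have "(x + A *v x) \<bullet> (A *v (x + A *v x)) = 0"
      by (rule assms)
    then have "2 * ((A *v x) \<bullet> (A *v x)) = 0"
      using assms(2)[of x] assms(2)[of "A *v x"] sym_dot[OF assms(1), of x "A *v x"]
      by (simp add: matrix_vector_right_distrib inner_add_left inner_add_right)
    then show ?thesis by simp
  qed
  then show ?thesis
    by (simp add: matrix_eq)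
qed

section \<open>The spectral theorem\<close>

text \<open>The form in which first-order conditions at minimizers of quadratic forms are used below.\<close>

lemma quadratic_no_linear_term:
  fixes a c :: real
  assumes c: "0 \<le> c" and nonneg: "\<And>s. 0 \<le> s\<^sup>2 * c - 2 * s * a"
  shows "a = 0"
proof (rule ccontr)
  assume "a \<noteq> 0"
  have "(a / (c + 1))\<^sup>2 * c - 2 * (a / (c + 1)) * a = - (a\<^sup>2 * (c + 2)) / (c + 1)\<^sup>2"
    using c by (simp add: divide_simps power2_eq_square) (simp add: algebra_simps)
  also have "\<dots> < 0" using c \<open>a \<noteq> 0\<close> by (simp add: divide_neg_pos)
  finally show False using nonneg[of "a / (c + 1)"] by simp
qed

text \<open>The quadratic form attains its minimum on the compact unit sphere of \<open>V\<close>.  By invariance the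
  residual \<open>A *v v - \<mu> *\<^sub>R v\<close> lies in \<open>V\<close>, and the first variation in its direction forces it to
  vanish.\<close>

lemma rayleigh_minimizer:
  fixes A :: "real^'n^'n"
  assumes sym: "transpose A = A" and V: "subspace V" "\<And>x. x \<in> V \<Longrightarrow> A *v x \<in> V"
    and nz: "\<exists>x\<in>V. x \<noteq> 0"
  obtains v \<mu> where "v \<in> V" "norm v = 1" "A *v v = \<mu> *\<^sub>R v"
    "\<And>x. x \<in> V \<Longrightarrow> \<mu> * (x \<bullet> x) \<le> x \<bullet> (A *v x)"
proof -
  let ?S = "sphere 0 1 \<inter> V"
  have comp: "compact ?S"
    by (intro compact_Int_closed compact_sphere closed_subspace V)
  obtain x0 where x0: "x0 \<in> V" "x0 \<noteq> 0" using nz by blast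
  have "x0 /\<^sub>R norm x0 \<in> ?S"
    using x0 V by (simp add: subspace_scale)
  then have ne: "?S \<noteq> {}" by blast
  have "continuous_on ?S (\<lambda>x. x \<bullet> (A *v x))"
    by (intro continuous_intros linear_continuous_on matrix_vector_mul_bounded_linear)
  from continuous_attains_inf[OF comp ne this]
  obtain v where v: "v \<in> ?S" and min: "\<And>y. y \<in> ?S \<Longrightarrow> v \<bullet> (A *v v) \<le> y \<bullet> (A *v y)"
    by blast
  define \<mu> where "\<mu> = v \<bullet> (A *v v)"
  have vv: "v \<bullet> v = 1" "norm v = 1" "v \<in> V" using v by (auto simp: dot_square_norm)
  have ray: "\<mu> * (x \<bullet> x) \<le> x \<bullet> (A *v x)" if "x \<in> V" for x
  proof (cases "x = 0")
    case False
    have "x /\<^sub>R norm x \<in> ?S" using that False V by (simp add: subspace_scale)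
    from min[OF this] have "\<mu> \<le> (x \<bullet> (A *v x)) / (norm x)\<^sup>2"
      by (simp add: \<mu>_def matrix_vector_mult_scaleR divide_inverse power2_eq_square mult_ac)
    then show ?thesis using False
      by (simp add: field_simps dot_square_norm)
  qed simp
  \<comment> \<open>The derivative of the Rayleigh quotient at \<open>v\<close> in the direction of the residual vanishes.\<close>
  define r where "r = A *v v - \<mu> *\<^sub>R v"
  have rV: "r \<in> V" unfolding r_def using vv V by (intro subspace_diff subspace_scale) auto
  have vr: "v \<bullet> r = 0" by (simp add: r_def inner_diff_right \<mu>_def vv)
  have Avr: "(A *v v) \<bullet> r = r \<bullet> r"
    using vr by (simp add: r_def inner_diff_left inner_diff_right inner_commute)
  have "r \<bullet> r = 0"
  proof (rule quadratic_no_linear_term)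
    define c where "c = r \<bullet> (A *v r) - \<mu> * (r \<bullet> r)"
    show "0 \<le> c" using ray[OF rV] by (simp add: c_def)
    show "0 \<le> s\<^sup>2 * c - 2 * s * (r \<bullet> r)" for s
    proof -
      have "v - s *\<^sub>R r \<in> V" using vv V rV by (intro subspace_diff subspace_scale) auto
      from ray[OF this] show ?thesis
        using sym_dot[OF sym, of v r] vr Avr vv
        by (simp add: c_def inner_diff_left inner_diff_right matrix_vector_mult_diff_distrib
            matrix_vector_mult_scaleR \<mu>_def[symmetric] inner_commute algebra_simps power2_eq_square)
    qed
  qed
  then have "A *v v = \<mu> *\<^sub>R v" by (simp add: r_def)
  with vv ray show thesis by (intro that) auto
qed

lemma min_eigenvector:
  fixes A :: "real^'n^'n"
  assumes "transpose A = A"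
  obtains v \<mu> where "norm v = 1" "A *v v = \<mu> *\<^sub>R v" "\<And>x. \<mu> * (x \<bullet> x) \<le> x \<bullet> (A *v x)"
proof -
  have "\<exists>x\<in>UNIV. x \<noteq> (0::real^'n)"
    by (metis UNIV_I axis_eq_0_iff zero_neq_one)
  from rayleigh_minimizer[OF assms subspace_UNIV _ this] show thesis
    by (metis UNIV_I that)
qed

lemma max_eigenvector:
  fixes A :: "real^'n^'n"
  assumes "transpose A = A"
  obtains v \<mu> where "norm v = 1" "A *v v = \<mu> *\<^sub>R v" "\<And>x. x \<bullet> (A *v x) \<le> \<mu> * (x \<bullet> x)"
proof -
  have "transpose ((-1) *\<^sub>R A) = (-1) *\<^sub>R A" by (simp only: transpose_scalar assms)
  from min_eigenvector[OF this] obtain v \<mu>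
    where v: "norm v = 1" "((-1) *\<^sub>R A) *v v = \<mu> *\<^sub>R v"
      "\<And>x. \<mu> * (x \<bullet> x) \<le> x \<bullet> (((-1) *\<^sub>R A) *v x)"
    by blast
  have neg: "((-1) *\<^sub>R A) *v x = - (A *v x)" for x
    by (simp only: scaleR_matrix_vector_assoc[symmetric]) simp
  show thesis
  proof (rule that[of v "- \<mu>"])
    show "A *v v = - \<mu> *\<^sub>R v" using v(2) unfolding neg by (metis minus_minus scaleR_minus_left)
    show "x \<bullet> (A *v x) \<le> - \<mu> * (x \<bullet> x)" for x using v(3)[of x] unfolding neg by simp
  qed (rule v)
qed

text \<open>A maximal orthonormal family of eigenvectors spans the space: the orthogonal complement of
  its span is invariant, so a nonzero complement would contain another eigenvector.\<close>

lemma spectral_theorem: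
  fixes A :: "real^'n^'n"
  assumes sym: "transpose A = A"
  obtains B l where "finite B" "pairwise orthogonal B" "\<And>v. v \<in> B \<Longrightarrow> norm v = 1"
    "\<And>v. v \<in> B \<Longrightarrow> A *v v = l v *\<^sub>R v" "span B = UNIV"
proof -
  define good where "good B \<longleftrightarrow> pairwise orthogonal B \<and> (\<forall>v\<in>B. norm v = 1 \<and> (\<exists>\<mu>. A *v v = \<mu> *\<^sub>R v))"
    for B :: "(real^'n) set"
  have indep: "independent B" if "good B" for B
    using that unfolding good_def
    by (intro pairwise_orthogonal_independent) (auto simp: norm_eq_zero[symmetric])
  have bound: "finite B \<and> card B \<le> DIM(real^'n)" if "good B" for B
    using independent_bound[OF indep[OF that]] .
  have "good {}" by (simp add: good_def)
  moreover have "\<forall>C. good C \<longrightarrow> card C < Suc (DIM(real^'n))" using bound by (simp add: less_Suc_eq_le)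
  ultimately have "\<exists>B. good B \<and> (\<forall>C. good C \<longrightarrow> card C \<le> card B)"
    by (rule ex_has_greatest_nat)
  then obtain B where B: "good B" and max: "\<And>C. good C \<Longrightarrow> card C \<le> card B" by auto
  have fin: "finite B" using bound[OF B] by simp
  obtain l where l: "\<And>v. v \<in> B \<Longrightarrow> A *v v = l v *\<^sub>R v" using B unfolding good_def by metis
  have "span B = UNIV"
  proof (rule ccontr)
    assume nsp: "span B \<noteq> UNIV"
    define V where "V = {x. \<forall>v\<in>B. v \<bullet> x = 0}"
    have subV: "subspace V"
      by (auto simp: V_def subspace_def inner_add_right)
    have invV: "A *v x \<in> V" if "x \<in> V" for x
      using that by (simp add: V_def sym_dot[OF sym] l)
    have "\<exists>x\<in>V. x \<noteq> 0"
    proof -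
      obtain y where y: "y \<noteq> 0" "\<And>x. x \<in> span B \<Longrightarrow> orthogonal y x"
        using orthogonal_to_subspace_exists_gen[of B UNIV] nsp by auto
      have "y \<in> V" using y(2)[OF span_base] unfolding V_def orthogonal_def by (simp add: inner_commute)
      with y show ?thesis by blast
    qed
    from rayleigh_minimizer[OF sym subV invV this] obtain v \<mu>
      where v: "v \<in> V" "norm v = 1" "A *v v = \<mu> *\<^sub>R v" by metis
    have "v \<notin> B" using v by (auto simp: V_def)
    moreover have "good (insert v B)"
      using B v unfolding good_def pairwise_insert by (auto simp: V_def orthogonal_def inner_commute)
    ultimately show False using max[of "insert v B"] fin by simp
  qed
  with B l fin show thesis by (intro that[of B l]) (auto simp: good_def)
qed

section \<open>Positive semidefinite matrices and square roots\<close>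

lemma spd_psd: "A \<in> spd_matrices \<Longrightarrow> psd A"
  unfolding spd_matrices_def psd_def by (auto, metis inner_zero_left less_eq_real_def)

lemma psd_sym: "psd A \<Longrightarrow> transpose A = A"
  by (simp add: psd_def)

lemma spd_sym: "A \<in> spd_matrices \<Longrightarrow> transpose A = A"
  by (simp add: spd_matrices_def)

text \<open>Such an \<open>x\<close> minimizes the quadratic form, so the first variation \<open>A *v x\<close> vanishes.\<close>

lemma psd_kernel:
  fixes A :: "real^'n^'n"
  assumes A: "psd A" and x: "x \<bullet> (A *v x) = 0"
  shows "A *v x = 0"
proof -
  define y where "y = A *v x"
  have "y \<bullet> y = 0"
  proof (rule quadratic_no_linear_term)
    show "0 \<le> y \<bullet> (A *v y)" using A by (simp add: psd_def)
    show "0 \<le> s\<^sup>2 * (y \<bullet> (A *v y)) - 2 * s * (y \<bullet> y)" for s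
    proof -
      have "0 \<le> (x - s *\<^sub>R y) \<bullet> (A *v (x - s *\<^sub>R y))" using A by (simp add: psd_def)
      then show ?thesis
        using sym_dot[OF psd_sym[OF A], of x y] x
        by (simp add: inner_diff_left inner_diff_right matrix_vector_mult_diff_distrib
            matrix_vector_mult_scaleR y_def[symmetric] inner_commute algebra_simps power2_eq_square)
    qed
  qed
  then show ?thesis by (simp add: y_def)
qed

lemma psd_sqrt_exists:
  fixes A :: "real^'n^'n"
  assumes A: "psd A"
  obtains R where "psd R" "R ** R = A"
proof -
  from spectral_theorem[OF psd_sym[OF A]] obtain B l where
    B: "finite B" "pairwise orthogonal B" "\<And>v. v \<in> B \<Longrightarrow> norm v = 1"
    "\<And>v. v \<in> B \<Longrightarrow> A *v v = l v *\<^sub>R v" "span B = (UNIV :: (real^'n) set)" by metis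
  have l: "0 \<le> l v" if "v \<in> B" for v
  proof -
    have "0 \<le> v \<bullet> (A *v v)" using A by (simp add: psd_def)
    then show ?thesis using B(3,4)[OF that] by (simp add: dot_square_norm)
  qed
  define R where "R = (\<Sum>v\<in>B. sqrt (l v) *\<^sub>R outer v v)"
  have outer_mult: "outer v v *v x = (v \<bullet> x) *\<^sub>R v" for v x :: "real^'n"
    by (simp add: outer_def matrix_vector_mult_def vec_eq_iff inner_vec_def sum_distrib_left mult_ac)
  have Rx: "R *v x = (\<Sum>v\<in>B. (sqrt (l v) * (v \<bullet> x)) *\<^sub>R v)" for x
  proof -
    have "(\<Sum>v\<in>C. sqrt (l v) *\<^sub>R outer v v) *v x = (\<Sum>v\<in>C. (sqrt (l v) * (v \<bullet> x)) *\<^sub>R v)"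
      if "finite C" for C
      using that by induction
        (simp_all add: matrix_vector_mult_add_rdistrib scaleR_matrix_vector_assoc[symmetric] outer_mult)
    with B(1) show ?thesis by (simp add: R_def)
  qed
  have orth: "v \<bullet> w = (if v = w then 1 else 0)" if "v \<in> B" "w \<in> B" for v w
    using that B(2,3) by (auto simp: pairwise_def orthogonal_def dot_square_norm)
  have Rv: "R *v v = sqrt (l v) *\<^sub>R v" if "v \<in> B" for v
  proof -
    have "R *v v = (\<Sum>w\<in>B. if w = v then sqrt (l v) *\<^sub>R v else 0)"
      unfolding Rx using that by (intro sum.cong) (auto simp: orth)
    then show ?thesis using that B(1) by simp
  qed
  have tR: "transpose R = R"
  proof -
    have "transpose (outer v v) = outer v v" for v :: "real^'n"
      by (simp add: outer_def transpose_def mult.commute vec_eq_iff)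
    then have "transpose (\<Sum>v\<in>C. sqrt (l v) *\<^sub>R outer v v) = (\<Sum>v\<in>C. sqrt (l v) *\<^sub>R outer v v)"
      if "finite C" for C using that
      by induction (simp_all add: transpose_distribs, simp add: transpose_def vec_eq_iff)
    with B(1) show ?thesis by (simp add: R_def)
  qed
  have "psd R"
    unfolding psd_def
  proof (intro conjI allI tR)
    fix x
    have "x \<bullet> (R *v x) = (\<Sum>v\<in>B. sqrt (l v) * (v \<bullet> x)\<^sup>2)"
      by (simp add: Rx inner_sum_right power2_eq_square inner_commute mult.assoc)
    also have "\<dots> \<ge> 0" using l by (intro sum_nonneg) simp
    finally show "0 \<le> x \<bullet> (R *v x)" .
  qed
  moreover have "R ** R = A"
  proof -
    have eq: "(R ** R) *v v = A *v v" if "v \<in> B" for v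
      using that l[OF that]
      by (simp add: matrix_vector_mul_assoc[symmetric] Rv matrix_vector_mult_scaleR B)
    have "(R ** R) *v x = A *v x" for x
      using linear_eq_on_span[of "(*v) (R ** R)" "(*v) A" B x] eq B(5)
      by (auto intro: matrix_vector_mul_linear)
    then show ?thesis by (simp add: matrix_eq)
  qed
  ultimately show thesis by (rule that)
qed

text \<open>Operator monotonicity of the square root.  If \<open>v\<close> is an eigenvector of \<open>P - Q\<close> with
  eigenvalue \<open>\<mu>\<close>, then \<open>P\<^sup>2 - Q\<^sup>2\<close> takes the value \<open>\<mu> * (v \<bullet> (P + Q) v)\<close> at \<open>v\<close>, because it is
  the symmetrized product of \<open>P - Q\<close> and \<open>P + Q\<close>; so \<open>\<mu>\<close> cannot be negative.\<close>

lemma psd_square_mono: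
  fixes P Q :: "real^'n^'n"
  assumes P: "psd P" and Q: "psd Q"
    and le: "\<And>x. x \<bullet> ((Q ** Q) *v x) \<le> x \<bullet> ((P ** P) *v x)"
  shows "x \<bullet> (Q *v x) \<le> x \<bullet> (P *v x)"
proof -
  have sP: "transpose P = P" and sQ: "transpose Q = Q" using P Q psd_sym by auto
  have "transpose (P - Q) = P - Q" by (simp add: transpose_diff sP sQ)
  from min_eigenvector[OF this] obtain v \<mu> where
    v: "norm v = 1" "(P - Q) *v v = \<mu> *\<^sub>R v" "\<And>x. \<mu> * (x \<bullet> x) \<le> x \<bullet> ((P - Q) *v x)" by blast
  have Pv: "P *v v = Q *v v + \<mu> *\<^sub>R v"
    using v(2) by (simp add: matrix_vector_mult_diff_rdistrib algebra_simps)
  have vv: "v \<bullet> v = 1" using v by (simp add: dot_square_norm)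
  have "0 \<le> \<mu>"
  proof (rule ccontr)
    assume neg: "\<not> 0 \<le> \<mu>"
    have sq: "x \<bullet> ((M ** M) *v x) = (M *v x) \<bullet> (M *v x)" if "transpose M = M" for M :: "real^'n^'n" and x
      by (simp add: matrix_vector_mul_assoc[symmetric] sym_dot[OF that])
    have a: "0 \<le> v \<bullet> (Q *v v)" "0 \<le> v \<bullet> (P *v v)" using P Q by (auto simp: psd_def)
    have "(Q *v v) \<bullet> (Q *v v) \<le> (P *v v) \<bullet> (P *v v)" using le[of v] sq[OF sP] sq[OF sQ] by simp
    then have "0 \<le> \<mu> * (v \<bullet> (Q *v v) + v \<bullet> (P *v v))"
      unfolding Pv by (simp add: inner_add_left inner_add_right vv inner_commute algebra_simps)
    with neg a have s: "v \<bullet> (Q *v v) + v \<bullet> (P *v v) = 0"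
      by (smt (verit) mult_neg_pos)
    have "v \<bullet> (P *v v) = v \<bullet> (Q *v v) + \<mu>" by (simp add: Pv inner_add_right vv)
    with s a neg show False by linarith
  qed
  have "0 \<le> x \<bullet> ((P - Q) *v x)"
    using v(3)[of x] \<open>0 \<le> \<mu>\<close> by (smt (verit) inner_ge_zero mult_nonneg_nonneg)
  then show ?thesis by (simp add: matrix_vector_mult_diff_rdistrib inner_diff_right)
qed

lemma psd_sqrt_unique:
  fixes P Q :: "real^'n^'n"
  assumes P: "psd P" and Q: "psd Q" and eq: "P ** P = Q ** Q"
  shows "P = Q"
proof -
  have "P - Q = 0"
  proof (rule symmetric_eq_zero)
    show "transpose (P - Q) = P - Q" using P Q by (simp add: transpose_diff psd_sym)
    show "x \<bullet> ((P - Q) *v x) = 0" for x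
      using psd_square_mono[OF P Q, of x] psd_square_mono[OF Q P, of x] eq
      by (simp add: matrix_vector_mult_diff_rdistrib inner_diff_right)
  qed
  then show ?thesis by simp
qed

lemma msqrt_eqI: "psd R \<Longrightarrow> R ** R = A \<Longrightarrow> msqrt A = R"
  unfolding msqrt_def by (rule the_equality) (auto intro: psd_sqrt_unique)

lemma
  assumes "psd A"
  shows psd_msqrt: "psd (msqrt A)" and msqrt_square: "msqrt A ** msqrt A = A"
  using psd_sqrt_exists[OF assms] msqrt_eqI by metis+

lemma psd_congruence:
  fixes A :: "real^'n^'n" and X :: "real^'n^'m"
  assumes "psd A" shows "psd (X ** A ** transpose X)"
proof -
  have "x \<bullet> ((X ** A ** transpose X) *v x) = (transpose X *v x) \<bullet> (A *v (transpose X *v x))" for x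
    by (simp only: matrix_vector_mul_assoc[symmetric] dot_matrix_vector_transpose[of x X])
  then show ?thesis using assms unfolding psd_def
    by (simp only: matrix_transpose_mul transpose_transpose matrix_mul_assoc) auto
qed

text \<open>With \<open>R = msqrt A\<close> the inner product is the trace of the psd matrix \<open>R ** B ** R\<close>.\<close>

lemma psd_inner_nonneg:
  fixes A B :: "real^'n^'n"
  assumes A: "psd A" and B: "psd B" shows "0 \<le> A \<bullet> B"
proof -
  define R where "R = msqrt A"
  have R: "transpose R = R" "R ** R = A" using A psd_msqrt msqrt_square psd_sym by (auto simp: R_def)
  have "A \<bullet> B = trace (R ** B ** transpose R)"
    using R by (metis inner_matrix_eq_trace matrix_mul_assoc matrix_transpose_mul trace_mul_sym)
  also have "\<dots> \<ge> 0"
  proof -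
    have "psd M \<Longrightarrow> 0 \<le> trace M" for M :: "real^'n^'n"
    proof -
      assume M: "psd M"
      have "0 \<le> M $ i $ i" for i
      proof -
        have "0 \<le> axis i 1 \<bullet> (M *v axis i 1)" using M unfolding psd_def by blast
        then show ?thesis by (simp add: matrix_vector_mult_basis inner_axis' column_def)
      qed
      then show ?thesis unfolding trace_def by (simp add: sum_nonneg)
    qed
    then show ?thesis using psd_congruence[OF B] by blast
  qed
  finally show ?thesis .
qed

section \<open>Positive definite matrices\<close>

lemma spd_kernel: "A \<in> spd_matrices \<Longrightarrow> A *v x = 0 \<Longrightarrow> x = 0"
  unfolding spd_matrices_def by auto

lemma psd_trivial_kernel_spd:
  assumes "psd A" "\<And>x. A *v x = 0 \<Longrightarrow> x = 0" shows "A \<in> spd_matrices"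
  using assms psd_kernel[OF assms(1)] unfolding spd_matrices_def psd_def
  by (auto simp: less_le)

lemma
  fixes A :: "real^'n^'n"
  assumes "A \<in> spd_matrices"
  shows spd_inv_left: "matrix_inv A ** A = mat 1" and spd_inv_right: "A ** matrix_inv A = mat 1"
proof -
  have "\<exists>B. B ** A = mat 1"
    using spd_kernel[OF assms] unfolding matrix_left_invertible_ker by blast
  then have "\<exists>B. A ** B = mat 1 \<and> B ** A = mat 1" by (metis matrix_left_right_inverse)
  then have "A ** matrix_inv A = mat 1 \<and> matrix_inv A ** A = mat 1"
    unfolding matrix_inv_def by (rule someI_ex)
  then show "matrix_inv A ** A = mat 1" "A ** matrix_inv A = mat 1" by auto
qed

lemma spd_congruence:
  fixes A X :: "real^'n^'n"
  assumes A: "A \<in> spd_matrices" and X: "transpose X = X" "\<And>x. X *v x = 0 \<Longrightarrow> x = 0"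
  shows "X ** A ** X \<in> spd_matrices"
proof (rule psd_trivial_kernel_spd)
  show "psd (X ** A ** X)" using psd_congruence[OF spd_psd[OF A], of X] X by simp
  show "x = 0" if "(X ** A ** X) *v x = 0" for x
  proof -
    have "X *v (A *v (X *v x)) = 0" using that by (simp add: matrix_vector_mul_assoc matrix_mul_assoc)
    then show ?thesis using X(2) spd_kernel[OF A] by blast
  qed
qed

lemma spd_congruence_spd:
  assumes A: "A \<in> spd_matrices" and S: "S \<in> spd_matrices"
  shows "S ** A ** S \<in> (spd_matrices :: (real^'n^'n) set)"
  by (rule spd_congruence[OF A spd_sym[OF S]]) (rule spd_kernel[OF S])

lemma spd_inv:
  assumes A: "A \<in> spd_matrices" shows "matrix_inv A \<in> spd_matrices"
proof -
  let ?J = "matrix_inv A"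
  have "transpose ?J ** A = mat 1"
    by (metis A matrix_transpose_mul spd_inv_right spd_sym transpose_mat)
  then have sym: "transpose ?J = ?J"
    by (metis A matrix_mul_assoc matrix_mul_lid matrix_mul_rid spd_inv_right)
  have ker: "x = 0" if "?J *v x = 0" for x
    using that spd_inv_right[OF A]
    by (metis matrix_vector_mul_assoc matrix_vector_mul_lid matrix_vector_mult_0_right)
  from spd_congruence[OF A sym ker] show ?thesis
    by (simp add: spd_inv_left[OF A])
qed

lemma spd_msqrt:
  assumes A: "A \<in> spd_matrices" shows "msqrt A \<in> spd_matrices"
proof (rule psd_trivial_kernel_spd)
  show "psd (msqrt A)" by (rule psd_msqrt[OF spd_psd[OF A]])
  show "x = 0" if "msqrt A *v x = 0" for x
    using that spd_kernel[OF A] msqrt_square[OF spd_psd[OF A]]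
    by (metis matrix_vector_mul_assoc matrix_vector_mult_0_right)
qed

lemma spd_mat1: "mat 1 \<in> spd_matrices"
  by (simp add: spd_matrices_def)

section \<open>Optimal transport maps between centered Gaussians\<close>

text \<open>The linear Brenier map from \<open>N(0, A)\<close> to \<open>N(0, B)\<close>.\<close>

abbreviation transport :: "real^'n^'n \<Rightarrow> real^'n^'n \<Rightarrow> real^'n^'n" where
  "transport A B \<equiv> geometric_mean (matrix_inv A) B"

text \<open>The square root of the inverse, through which the geometric mean is written, is the inverse of
  the square root \<open>N\<close> of \<open>A\<close>.\<close>

lemma msqrt_inverse_facts:
  fixes A B :: "real^'n^'n"
  assumes A: "A \<in> spd_matrices" and B: "B \<in> spd_matrices"
  defines "R \<equiv> msqrt (matrix_inv A)" and "N \<equiv> msqrt A"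
  shows "matrix_inv R = N" "N ** R = mat 1" "R ** N = mat 1"
    "transport A B = R ** msqrt (N ** B ** N) ** R"
    "R \<in> spd_matrices" "N \<in> spd_matrices" "N ** B ** N \<in> spd_matrices"
    "N ** N = A" "R ** R = matrix_inv A"
proof -
  show R: "R \<in> spd_matrices" unfolding R_def by (intro spd_msqrt spd_inv A)
  show RR: "R ** R = matrix_inv A" unfolding R_def by (intro msqrt_square spd_psd spd_inv A)
  let ?J = "matrix_inv R"
  have J: "?J \<in> spd_matrices" by (rule spd_inv[OF R])
  have "(?J ** ?J) ** (R ** R) = mat 1"
    by (metis R matrix_mul_assoc matrix_mul_lid spd_inv_left)
  then have "?J ** ?J = A"
    by (metis A RR matrix_mul_assoc matrix_mul_lid matrix_mul_rid spd_inv_left)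
  then show JN: "?J = N" unfolding N_def using msqrt_eqI[OF spd_psd[OF J]] by simp
  show "N ** R = mat 1" "R ** N = mat 1" using JN spd_inv_left[OF R] spd_inv_right[OF R] by auto
  show N: "N \<in> spd_matrices" using J JN by simp
  show "N ** N = A" unfolding N_def by (intro msqrt_square spd_psd A)
  show "transport A B = R ** msqrt (N ** B ** N) ** R"
    unfolding geometric_mean_def R_def[symmetric] JN ..
  show "N ** B ** N \<in> spd_matrices" by (intro spd_congruence B spd_sym N) (rule spd_kernel[OF N])
qed

lemma transport_spd:
  fixes A B :: "real^'n^'n"
  assumes A: "A \<in> spd_matrices" and B: "B \<in> spd_matrices"
  shows "transport A B \<in> spd_matrices"
proof -
  note t = msqrt_inverse_facts[OF A B]
  show ?thesis unfolding t(4)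
    by (intro spd_congruence spd_msqrt t(7) spd_sym t(5)) (rule spd_kernel[OF t(5)])
qed

lemma transport_pushforward:
  fixes A B :: "real^'n^'n"
  assumes A: "A \<in> spd_matrices" and B: "B \<in> spd_matrices"
  shows "transport A B ** A ** transport A B = B"
proof -
  note t = msqrt_inverse_facts[OF A B]
  define R N M where "R = msqrt (matrix_inv A)" and "N = msqrt A" and "M = msqrt (N ** B ** N)"
  note t = t[folded R_def N_def, folded M_def]
  have MM: "M ** M = N ** B ** N" unfolding M_def by (intro msqrt_square spd_psd t(7))
  have "R ** A ** R = mat 1"
    using t(2,3,8) by (metis matrix_mul_assoc matrix_mul_lid)
  then have "transport A B ** A ** transport A B = R ** (M ** M) ** R"
    unfolding t(4) by (metis matrix_mul_assoc matrix_mul_rid)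
  also have "\<dots> = B"
    unfolding MM using t(2,3) by (metis matrix_mul_assoc matrix_mul_lid matrix_mul_rid)
  finally show ?thesis .
qed

lemma W2_sq_transport:
  fixes A B :: "real^'n^'n"
  assumes A: "A \<in> spd_matrices" and B: "B \<in> spd_matrices"
  shows "W2_sq A B = trace A + trace B - 2 * trace (transport A B ** A)"
proof -
  note t = msqrt_inverse_facts[OF A B]
  define R N M where "R = msqrt (matrix_inv A)" and "N = msqrt A" and "M = msqrt (N ** B ** N)"
  note t = t[folded R_def N_def, folded M_def]
  have "trace (transport A B ** A) = trace (R ** (M ** R ** N ** N))"
    unfolding t(4) by (simp add: t(8)[symmetric] matrix_mul_assoc)
  also have "\<dots> = trace (M ** R ** N ** N ** R)" by (rule trace_mul_sym)
  also have "\<dots> = trace M"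
    using t(2,3) by (metis matrix_mul_assoc matrix_mul_rid)
  finally show ?thesis unfolding W2_sq_def N_def[symmetric] M_def[symmetric]
    by (simp add: trace_sub trace_add) (simp add: trace_def sum_distrib_left)
qed

text \<open>Conjugating by \<open>msqrt A\<close> turns the equation \<open>X ** A ** X = B\<close> into one for a square
  root, so order and uniqueness are inherited from square roots.\<close>

lemma congruence_square_mono:
  fixes A X Y :: "real^'n^'n"
  assumes A: "A \<in> spd_matrices" and X: "psd X" and Y: "psd Y"
    and le: "\<And>x. x \<bullet> ((Y ** A ** Y) *v x) \<le> x \<bullet> ((X ** A ** X) *v x)"
  shows "x \<bullet> (Y *v x) \<le> x \<bullet> (X *v x)"
proof -
  note t = msqrt_inverse_facts[OF A A]
  define R N where "R = msqrt (matrix_inv A)" and "N = msqrt A"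
  note t = t[folded R_def N_def]
  have sN: "transpose N = N" using t(6) spd_sym by blast
  have conj: "x \<bullet> ((N ** Z ** N) *v x) = (N *v x) \<bullet> (Z *v (N *v x))" for Z x
    by (simp add: matrix_vector_mul_assoc[symmetric] sym_dot[OF sN])
  have sq: "(N ** Z ** N) ** (N ** Z ** N) = N ** (Z ** A ** Z) ** N" for Z
    unfolding t(8)[symmetric] by (simp add: matrix_mul_assoc)
  have p: "psd (N ** Z ** N)" if "psd Z" for Z using psd_congruence[OF that, of N] sN by simp
  have "(R *v x) \<bullet> ((N ** Y ** N) *v (R *v x)) \<le> (R *v x) \<bullet> ((N ** X ** N) *v (R *v x))"
    by (rule psd_square_mono[OF p[OF X] p[OF Y]]) (simp only: sq conj le)
  then show ?thesis
    unfolding conj by (simp add: matrix_vector_mul_assoc t)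
qed

lemma transport_unique:
  fixes A B X :: "real^'n^'n"
  assumes A: "A \<in> spd_matrices" and B: "B \<in> spd_matrices" and X: "psd X" and eq: "X ** A ** X = B"
  shows "X = transport A B"
proof -
  let ?T = "transport A B"
  have T: "psd ?T" by (rule spd_psd[OF transport_spd[OF A B]])
  have "X - ?T = 0"
  proof (rule symmetric_eq_zero)
    show "transpose (X - ?T) = X - ?T" using X T by (simp add: transpose_diff psd_sym)
    show "x \<bullet> ((X - ?T) *v x) = 0" for x
      using congruence_square_mono[OF A X T, of x] congruence_square_mono[OF A T X, of x]
        eq transport_pushforward[OF A B]
      by (simp add: matrix_vector_mult_diff_rdistrib inner_diff_right)
  qed
  then show ?thesis by simp
qed

section \<open>Bounds on the spectrum\<close>

text \<open>Spectral bounds are stated through the quadratic form: in this shape they are closed conditions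
  and pass to averages.\<close>

definition eig_ge :: "real^'n^'n \<Rightarrow> real \<Rightarrow> bool" where
  "eig_ge A a \<longleftrightarrow> (\<forall>x. a * (x \<bullet> x) \<le> x \<bullet> (A *v x))"

definition eig_le :: "real^'n^'n \<Rightarrow> real \<Rightarrow> bool" where
  "eig_le A a \<longleftrightarrow> (\<forall>x. x \<bullet> (A *v x) \<le> a * (x \<bullet> x))"

lemma eig_ge_spd: "transpose A = A \<Longrightarrow> eig_ge A a \<Longrightarrow> 0 < a \<Longrightarrow> A \<in> spd_matrices"
  unfolding eig_ge_def spd_matrices_def by (auto intro: less_le_trans[rotated])

lemma spd_pos: "A \<in> spd_matrices \<Longrightarrow> x \<noteq> 0 \<Longrightarrow> 0 < x \<bullet> (A *v x)"
  by (simp add: spd_matrices_def)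

lemma eig_ge_mono: "eig_ge A a \<Longrightarrow> a' \<le> a \<Longrightarrow> eig_ge A a'"
  unfolding eig_ge_def by (meson inner_ge_zero mult_right_mono order_trans)

lemma eig_le_mono: "eig_le A b \<Longrightarrow> b \<le> b' \<Longrightarrow> eig_le A b'"
  unfolding eig_le_def by (meson inner_ge_zero mult_right_mono order_trans)

lemma eigenvalues_eig_bounds:
  fixes A :: "real^'n^'n"
  assumes "transpose A = A" "\<And>l. is_eigenvalue A l \<Longrightarrow> a \<le> l \<and> l \<le> b"
  shows "eig_ge A a \<and> eig_le A b"
proof -
  from min_eigenvector[OF assms(1)] obtain v \<mu> where
    v: "norm v = 1" "A *v v = \<mu> *\<^sub>R v" "\<And>x. \<mu> * (x \<bullet> x) \<le> x \<bullet> (A *v x)" by blast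
  from max_eigenvector[OF assms(1)] obtain w \<nu> where
    w: "norm w = 1" "A *v w = \<nu> *\<^sub>R w" "\<And>x. x \<bullet> (A *v x) \<le> \<nu> * (x \<bullet> x)" by blast
  have "is_eigenvalue A \<mu>" "is_eigenvalue A \<nu>" unfolding is_eigenvalue_def
    using v w by (metis norm_zero zero_neq_one)+
  then have "a \<le> \<mu>" "\<nu> \<le> b" using assms(2) by auto
  then show ?thesis unfolding eig_ge_def eig_le_def
    using v(3) w(3) by (meson inner_ge_zero mult_right_mono order_trans)
qed

text \<open>If \<open>v\<close> is an eigenvector of the transport map with eigenvalue \<open>\<mu>\<close>, the pushforward equation gives
  \<open>v \<bullet> (B *v v) = \<mu>\<^sup>2 * (v \<bullet> (A *v v))\<close>.\<close>

lemma transport_eig_ge: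
  fixes A B :: "real^'n^'n"
  assumes A: "A \<in> spd_matrices" "eig_le A a" and B: "B \<in> spd_matrices" "eig_ge B b"
    and "0 < a" "0 \<le> b"
  shows "eig_ge (transport A B) (sqrt (b / a))"
proof -
  let ?T = "transport A B"
  have T: "?T \<in> spd_matrices" by (rule transport_spd[OF A(1) B(1)])
  from min_eigenvector[OF spd_sym[OF T]] obtain v \<mu> where
    v: "norm v = 1" "?T *v v = \<mu> *\<^sub>R v" "\<And>x. \<mu> * (x \<bullet> x) \<le> x \<bullet> (?T *v x)" by blast
  have vv: "v \<bullet> v = 1" "v \<noteq> 0" using v by (auto simp: dot_square_norm)
  have "0 < v \<bullet> (?T *v v)" using T vv by (rule_tac spd_pos)
  then have mu: "0 < \<mu>" using v vv by simp
  have "v \<bullet> (B *v v) = v \<bullet> ((?T ** A ** ?T) *v v)"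
    using transport_pushforward[OF A(1) B(1)] by simp
  also have "\<dots> = \<mu>\<^sup>2 * (v \<bullet> (A *v v))"
    by (simp add: matrix_vector_mul_assoc[symmetric] sym_dot[OF spd_sym[OF T]] v
        matrix_vector_mult_scaleR power2_eq_square)
  finally have "b \<le> \<mu>\<^sup>2 * (v \<bullet> (A *v v))"
    using B(2) vv unfolding eig_ge_def by (metis mult.right_neutral)
  also have "\<dots> \<le> \<mu>\<^sup>2 * a" using A(2) vv unfolding eig_le_def by (metis mult.right_neutral mult_left_mono zero_le_power2)
  finally have "b / a \<le> \<mu>\<^sup>2" using \<open>0 < a\<close> by (simp add: field_simps)
  then have "sqrt (b / a) \<le> \<mu>" using mu by (simp add: real_le_lsqrt assms)
  then show ?thesis unfolding eig_ge_def using v(3) by (meson inner_ge_zero mult_right_mono order_trans)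
qed

lemma transport_eig_le:
  fixes A B :: "real^'n^'n"
  assumes A: "A \<in> spd_matrices" "eig_ge A a" and B: "B \<in> spd_matrices" "eig_le B b"
    and "0 < a"
  shows "eig_le (transport A B) (sqrt (b / a))"
proof -
  let ?T = "transport A B"
  have T: "?T \<in> spd_matrices" by (rule transport_spd[OF A(1) B(1)])
  from max_eigenvector[OF spd_sym[OF T]] obtain v \<mu> where
    v: "norm v = 1" "?T *v v = \<mu> *\<^sub>R v" "\<And>x. x \<bullet> (?T *v x) \<le> \<mu> * (x \<bullet> x)" by blast
  have vv: "v \<bullet> v = 1" using v by (auto simp: dot_square_norm)
  have "\<mu>\<^sup>2 * a \<le> \<mu>\<^sup>2 * (v \<bullet> (A *v v))"
    using A(2) vv unfolding eig_ge_def by (metis mult.right_neutral mult_left_mono zero_le_power2)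
  also have "\<dots> = v \<bullet> ((?T ** A ** ?T) *v v)"
    by (simp add: matrix_vector_mul_assoc[symmetric] sym_dot[OF spd_sym[OF T]] v
        matrix_vector_mult_scaleR power2_eq_square)
  also have "\<dots> \<le> b"
    using transport_pushforward[OF A(1) B(1)] B(2) vv unfolding eig_le_def by (metis mult.right_neutral)
  finally have "\<mu>\<^sup>2 \<le> b / a" using \<open>0 < a\<close> by (simp add: field_simps)
  then have "\<mu> \<le> sqrt (b / a)" by (rule real_le_rsqrt)
  then show ?thesis unfolding eig_le_def using v(3) by (meson inner_ge_zero mult_right_mono order_trans)
qed

section \<open>Coupling and duality bounds for the Wasserstein distance\<close>

lemma inverse_inner_mult:
  fixes T J Y :: "real^'n^'n"
  assumes "transpose T = T" "T ** J = mat 1"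
  shows "J \<bullet> (T ** Y) = trace Y" "J \<bullet> (Y ** T) = trace Y"
proof -
  show "J \<bullet> (T ** Y) = trace Y"
    using inner_matrix_mul_left[of T J Y] assms by (simp add: trace_eq_inner)
  show "J \<bullet> (Y ** T) = trace Y"
    using inner_matrix_mul_right[of J T Y] assms matrix_left_right_inverse[of T J] by (simp add: trace_eq_inner)
qed

lemma trace_transpose: "trace (transpose X) = trace (X :: real^'n^'n)"
  by (simp add: trace_def transpose_def)

lemma weighted_inner_one:
  fixes A Z :: "real^'n^'n"
  assumes "transpose A = A"
  shows "(Z - mat 1) \<bullet> ((Z - mat 1) ** A) = trace (Z ** A ** transpose Z) - 2 * trace (Z ** A) + trace A"
proof -
  have 1: "Z \<bullet> (Z ** A) = trace (Z ** A ** transpose Z)"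
    unfolding inner_matrix_eq_trace by (metis trace_mul_sym)
  have "Z \<bullet> A = trace (Z ** A)"
    by (metis assms inner_matrix_eq_trace inner_transpose trace_mul_sym transpose_transpose)
  with 1 show ?thesis
    by (simp add: matrix_distribs inner_diff_left inner_diff_right trace_eq_inner)
qed

text \<open>Every map \<open>Z\<close> that pushes \<open>N(0, A)\<close> to \<open>N(0, B)\<close> induces a coupling, and its cost exceeds the
  optimal one by a square: pair the inverse of the optimal map \<open>T\<close> with the psd matrix
  \<open>(Z - T) ** A ** transpose (Z - T)\<close>.\<close>

lemma W2_sq_le_coupling:
  fixes A B Z :: "real^'n^'n"
  assumes A: "A \<in> spd_matrices" and B: "B \<in> spd_matrices" and Z: "Z ** A ** transpose Z = B"
  shows "W2_sq A B \<le> (Z - mat 1) \<bullet> ((Z - mat 1) ** A)"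
proof -
  let ?T = "transport A B" and ?J = "matrix_inv (transport A B)"
  have T: "?T \<in> spd_matrices" by (rule transport_spd[OF A B])
  note sT = spd_sym[OF T] and sA = spd_sym[OF A]
  note J = inverse_inner_mult[OF sT spd_inv_right[OF T]]
  have "0 \<le> ?J \<bullet> ((Z - ?T) ** A ** transpose (Z - ?T))"
    by (intro psd_inner_nonneg psd_congruence spd_psd A spd_inv T)
  also have "(Z - ?T) ** A ** transpose (Z - ?T)
      = Z ** A ** transpose Z - Z ** A ** ?T - ?T ** (A ** transpose Z) + ?T ** (A ** ?T)"
    by (simp add: transpose_diff sT matrix_distribs matrix_mul_assoc)
  also have "?J \<bullet> \<dots> = ?J \<bullet> B - trace (Z ** A) - trace (A ** transpose Z) + trace (A ** ?T)"
    by (simp add: inner_add_right inner_diff_right J Z)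
  also have "?J \<bullet> B = trace (A ** ?T)"
    using J(1)[of "A ** ?T"] transport_pushforward[OF A B] by (simp add: matrix_mul_assoc)
  also have "trace (A ** transpose Z) = trace (Z ** A)"
    by (metis sA matrix_transpose_mul trace_transpose)
  finally show ?thesis
    unfolding weighted_inner_one[OF sA] Z W2_sq_transport[OF A B]
    by (simp add: trace_mul_sym[of A])
qed

lemma W2_sq_eq_weighted:
  fixes A B :: "real^'n^'n"
  assumes A: "A \<in> spd_matrices" and B: "B \<in> spd_matrices"
  shows "W2_sq A B = (transport A B - mat 1) \<bullet> ((transport A B - mat 1) ** A)"
  using weighted_inner_one[OF spd_sym[OF A], of "transport A B"]
    transport_pushforward[OF A B] spd_sym[OF transport_spd[OF A B]] W2_sq_transport[OF A B] by simp

lemma weighted_inner_nonneg: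
  fixes A X :: "real^'n^'n"
  assumes "psd A" shows "0 \<le> X \<bullet> (X ** A)"
proof -
  have "X \<bullet> (X ** A) = mat 1 \<bullet> (X ** A ** transpose X)"
    using inner_matrix_mul_right[of "mat 1" X "X ** A"]
    by (metis inner_matrix_mul_right matrix_mul_lid)
  then show ?thesis using psd_inner_nonneg[OF spd_psd[OF spd_mat1] psd_congruence[OF assms]] by simp
qed

text \<open>The form \<open>X \<bullet> (X ** A)\<close> is monotone in \<open>A\<close>.\<close>

lemma weighted_inner_ge:
  fixes A X :: "real^'n^'n"
  assumes "transpose A = A" "eig_ge A a" shows "a * (X \<bullet> X) \<le> X \<bullet> (X ** A)"
proof -
  have "psd (A - a *\<^sub>R mat 1)"
    using assms unfolding psd_def eig_ge_def
    by (simp add: transpose_distribs matrix_vector_mult_diff_rdistrib inner_diff_right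
        scaleR_matrix_vector_assoc[symmetric])
  from weighted_inner_nonneg[OF this, of X] show ?thesis
    by (simp add: matrix_distribs inner_diff_right)
qed

lemma weighted_inner_le:
  fixes A X :: "real^'n^'n"
  assumes "transpose A = A" "eig_le A b" shows "X \<bullet> (X ** A) \<le> b * (X \<bullet> X)"
proof -
  have "psd (b *\<^sub>R mat 1 - A)"
    using assms unfolding psd_def eig_le_def
    by (simp add: transpose_distribs matrix_vector_mult_diff_rdistrib inner_diff_right
        scaleR_matrix_vector_assoc[symmetric])
  from weighted_inner_nonneg[OF this, of X] show ?thesis
    by (simp add: matrix_distribs inner_diff_right)
qed

lemma W2_sq_nonneg: "A \<in> spd_matrices \<Longrightarrow> B \<in> spd_matrices \<Longrightarrow> 0 \<le> W2_sq A B"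
  by (simp add: W2_sq_eq_weighted weighted_inner_nonneg spd_psd)

text \<open>Write \<open>Q = transport A' B\<close> and \<open>T = transport A B\<close>.  The duality gap of the potential \<open>Q\<close>, tested
  on the pair \<open>(A, B)\<close>, is the pairing of \<open>Q\<close> with \<open>(Z - 1) ** A ** transpose (Z - 1)\<close> for
  \<open>Z = matrix_inv Q ** T\<close>.  Since \<open>Z\<close> pushes \<open>N(0, A)\<close> to \<open>N(0, A')\<close>, the gap is at least
  \<open>q * W2_sq A A'\<close>.\<close>

lemma W2_sq_duality:
  fixes A A' B :: "real^'n^'n"
  assumes A: "A \<in> spd_matrices" and A': "A' \<in> spd_matrices" and B: "B \<in> spd_matrices"
    and q: "eig_ge (transport A' B) q" "0 \<le> q"
  shows "W2_sq A' B + (mat 1 - transport A' B) \<bullet> (A - A') + q * W2_sq A A' \<le> W2_sq A B"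
proof -
  let ?Q = "transport A' B" and ?T = "transport A B"
  let ?J = "matrix_inv ?Q"
  let ?Z = "?J ** ?T"
  have Q: "?Q \<in> spd_matrices" by (rule transport_spd[OF A' B])
  have T: "?T \<in> spd_matrices" by (rule transport_spd[OF A B])
  have J: "?J \<in> spd_matrices" by (rule spd_inv[OF Q])
  note sT = spd_sym[OF T] and sA = spd_sym[OF A] and sJ = spd_sym[OF J] and sQ = spd_sym[OF Q]
  \<comment> \<open>Both \<open>?T\<close> and \<open>?Q\<close> push their sources to \<open>B\<close>; going forward along one and back along the other
    couples \<open>A\<close> with \<open>A'\<close>.\<close>
  have push: "?Z ** A ** transpose ?Z = A'"
  proof -
    have "?Z ** A ** transpose ?Z = ?J ** (?T ** A ** ?T) ** ?J"
      by (simp add: matrix_transpose_mul sT sJ matrix_mul_assoc)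
    also have "\<dots> = ?J ** (?Q ** A' ** ?Q) ** ?J"
      by (simp add: transport_pushforward[OF A B] transport_pushforward[OF A' B])
    also have "\<dots> = A'"
      using spd_inv_left[OF Q] spd_inv_right[OF Q] by (metis matrix_mul_assoc matrix_mul_lid matrix_mul_rid)
    finally show ?thesis .
  qed
  let ?C = "(?Z - mat 1) ** A ** transpose (?Z - mat 1)"
  have pC: "psd ?C" by (intro psd_congruence spd_psd A)
  have trC: "trace ?C = (?Z - mat 1) \<bullet> ((?Z - mat 1) ** A)"
    unfolding inner_matrix_eq_trace by (metis trace_mul_sym)
  have "psd (?Q - q *\<^sub>R mat 1)"
    using q(1) unfolding psd_def eig_ge_def
    by (simp add: transpose_distribs sQ matrix_vector_mult_diff_rdistrib inner_diff_right
        scaleR_matrix_vector_assoc[symmetric])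
  from psd_inner_nonneg[OF this pC]
  have "q * trace ?C \<le> ?Q \<bullet> ?C" by (simp add: inner_diff_left trace_eq_inner)
  moreover have "q * W2_sq A A' \<le> q * trace ?C"
    unfolding trC by (intro mult_left_mono q W2_sq_le_coupling A A' push)
  moreover have "?Q \<bullet> ?C = ?Q \<bullet> A' - 2 * trace (?T ** A) + ?Q \<bullet> A"
  proof -
    have "?C = ?Z ** A ** transpose ?Z - ?Z ** A - A ** transpose ?Z + A"
      by (simp add: transpose_diff matrix_distribs)
    then have "?Q \<bullet> ?C = ?Q \<bullet> A' - ?Q \<bullet> (?Z ** A) - ?Q \<bullet> (A ** transpose ?Z) + ?Q \<bullet> A"
      unfolding push by (simp add: inner_add_right inner_diff_right)
    moreover have "?Q \<bullet> (?Z ** A) = trace (?T ** A)"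
      using inverse_inner_mult(1)[OF sJ spd_inv_left[OF Q], of "?T ** A"]
      by (simp add: matrix_mul_assoc)
    moreover have "?Q \<bullet> (A ** transpose ?Z) = ?Q \<bullet> (?Z ** A)"
      by (metis inner_transpose matrix_transpose_mul sA sQ transpose_transpose)
    ultimately show ?thesis by simp
  qed
  ultimately have "q * W2_sq A A' \<le> ?Q \<bullet> A' - 2 * trace (?T ** A) + ?Q \<bullet> A" by linarith
  moreover have "trace (?Q ** A') = ?Q \<bullet> A'" by (simp add: inner_matrix_eq_trace sQ)
  ultimately show ?thesis
    unfolding W2_sq_transport[OF A B] W2_sq_transport[OF A' B]
    by (simp add: inner_diff_left inner_diff_right trace_eq_inner)
qed

text \<open>The inverse of the optimal map is a coupling in the opposite direction with the same cost.\<close>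

lemma W2_sq_commute:
  fixes A B :: "real^'n^'n"
  assumes A: "A \<in> spd_matrices" and B: "B \<in> spd_matrices"
  shows "W2_sq A B = W2_sq B A"
proof -
  have le: "W2_sq D C \<le> W2_sq C D" if C: "C \<in> spd_matrices" and D: "D \<in> spd_matrices" for C D :: "real^'n^'n"
  proof -
    let ?R = "transport C D" and ?J = "matrix_inv (transport C D)"
    have R: "?R \<in> spd_matrices" by (rule transport_spd[OF C D])
    have JD: "?J ** D = C ** ?R"
      using spd_inv_left[OF R] transport_pushforward[OF C D] by (metis matrix_mul_assoc matrix_mul_lid)
    have push: "?J ** D ** transpose ?J = C"
      unfolding JD using spd_inv_right[OF R] spd_sym[OF spd_inv[OF R]]
      by (metis matrix_mul_assoc matrix_mul_rid)
    have "trace (?J ** D) = trace (?R ** C)" unfolding JD by (rule trace_mul_sym)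
    with W2_sq_le_coupling[OF D C push] show ?thesis
      unfolding weighted_inner_one[OF spd_sym[OF D]] W2_sq_transport[OF C D] push by simp
  qed
  show ?thesis using le[OF A B] le[OF B A] by simp
qed

section \<open>Descent steps preserve spectral bounds\<close>

lemma psd_cauchy_schwarz:
  fixes A :: "real^'n^'n"
  assumes "psd A" shows "(x \<bullet> (A *v y))\<^sup>2 \<le> (x \<bullet> (A *v x)) * (y \<bullet> (A *v y))"
proof -
  define N where "N = msqrt A"
  have N: "transpose N = N" "N ** N = A"
    using psd_msqrt[OF assms] msqrt_square[OF assms] psd_sym by (auto simp: N_def)
  have "x \<bullet> (A *v y) = (N *v x) \<bullet> (N *v y)" for x y
    using sym_dot[OF N(1), of x "N *v y"] by (simp add: matrix_vector_mul_assoc N(2))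
  then show ?thesis by (simp add: Cauchy_Schwarz_ineq)
qed

lemma transport_mono:
  fixes A B B' :: "real^'n^'n"
  assumes "A \<in> spd_matrices" "B \<in> spd_matrices" "B' \<in> spd_matrices"
    "\<And>x. x \<bullet> (B' *v x) \<le> x \<bullet> (B *v x)"
  shows "x \<bullet> (transport A B' *v x) \<le> x \<bullet> (transport A B *v x)"
  by (rule congruence_square_mono[OF assms(1) spd_psd[OF transport_spd[OF assms(1,2)]]
        spd_psd[OF transport_spd[OF assms(1,3)]]])
    (simp only: transport_pushforward assms)

lemma congruence_quadratic_form:
  fixes A S :: "real^'n^'n"
  assumes "transpose S = S"
  shows "x \<bullet> ((S ** A ** S) *v x) = (S *v x) \<bullet> (A *v (S *v x))"
  by (simp add: matrix_vector_mul_assoc[symmetric] sym_dot[OF assms])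

lemma step_eig_le:
  fixes A G :: "real^'n^'n"
  assumes A: "psd A" "eig_le A b" and G: "transpose G = G" "eig_le (G ** A ** G) b"
    and \<eta>: "0 \<le> \<eta>" "\<eta> \<le> 1"
  defines "S \<equiv> (1 - \<eta>) *\<^sub>R mat 1 + \<eta> *\<^sub>R G"
  shows "eig_le (S ** A ** S) b"
  unfolding eig_le_def
proof
  fix x
  have sS: "transpose S = S" by (simp add: S_def transpose_distribs G)
  define y where "y = G *v x"
  have Sx: "S *v x = (1 - \<eta>) *\<^sub>R x + \<eta> *\<^sub>R y"
    by (simp add: S_def y_def matrix_vector_mult_add_rdistrib scaleR_matrix_vector_assoc[symmetric])
  have yx: "y \<bullet> (A *v x) = x \<bullet> (A *v y)"
    using sym_dot[OF psd_sym[OF A(1)], of y x] by (simp add: inner_commute)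
  have "0 \<le> (\<eta> * (1 - \<eta>)) * ((x - y) \<bullet> (A *v (x - y)))"
    using A(1) \<eta> by (simp add: psd_def)
  then have "(S *v x) \<bullet> (A *v (S *v x)) \<le> (1 - \<eta>) * (x \<bullet> (A *v x)) + \<eta> * (y \<bullet> (A *v y))"
    unfolding Sx by (simp add: matrix_vector_right_distrib matrix_vector_mult_scaleR
        matrix_vector_mult_diff_distrib inner_add_left inner_add_right inner_diff_left inner_diff_right yx)
      (simp add: algebra_simps)
  also have "\<dots> \<le> (1 - \<eta>) * (b * (x \<bullet> x)) + \<eta> * (b * (x \<bullet> x))"
    using A(2) G(2) \<eta> unfolding eig_le_def congruence_quadratic_form[OF G(1)] y_def
    by (intro add_mono mult_left_mono) auto
  also have "\<dots> = b * (x \<bullet> x)" by (simp add: algebra_simps)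
  finally show "x \<bullet> ((S ** A ** S) *v x) \<le> b * (x \<bullet> x)"
    by (simp add: congruence_quadratic_form[OF sS])
qed

text \<open>Cauchy--Schwarz for the form of \<open>A\<close> gives
  \<open>(x \<bullet> S x)\<^sup>2 \<le> (x \<bullet> A\<^sup>-\<^sup>1 x) * (x \<bullet> S A S x)\<close>.  Let \<open>U\<close> be the transport map to \<open>a I\<close>, which is below the
  identity, and put \<open>n = x \<bullet> x\<close> and \<open>m = x \<bullet> U x \<le> n\<close>.  From \<open>a A\<^sup>-\<^sup>1 = U\<^sup>2 \<le> U\<close> the first factor is
  at most \<open>m / a\<close>, and \<open>U \<le> G\<close> bounds \<open>x \<bullet> S x\<close> below by \<open>(1 - \<eta>) * n + \<eta> * m\<close>.  The square of the
  latter is at least \<open>n * m\<close> because \<open>\<eta> \<le> 1 / 2\<close>.\<close>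

lemma step_eig_ge:
  fixes A G :: "real^'n^'n"
  assumes A: "A \<in> spd_matrices" "eig_ge A a" "0 < a" and sG: "transpose G = G"
    and G: "\<And>x. x \<bullet> (transport A (a *\<^sub>R mat 1) *v x) \<le> x \<bullet> (G *v x)"
    and \<eta>: "0 \<le> \<eta>" "\<eta> \<le> 1 / 2"
  defines "S \<equiv> (1 - \<eta>) *\<^sub>R mat 1 + \<eta> *\<^sub>R G"
  shows "eig_ge (S ** A ** S) a"
  unfolding eig_ge_def
proof
  fix x
  have sS: "transpose S = S" by (simp add: S_def transpose_distribs sG)
  let ?U = "transport A (a *\<^sub>R mat 1)"
  have aI: "a *\<^sub>R mat 1 \<in> (spd_matrices :: (real^'n^'n) set)" "eig_le (a *\<^sub>R mat 1 :: real^'n^'n) a"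
    using A(3) by (auto simp: spd_matrices_def eig_le_def transpose_distribs scaleR_matrix_vector_assoc[symmetric])
  have U: "?U \<in> spd_matrices" by (rule transport_spd[OF A(1) aI(1)])
  note sU = spd_sym[OF U]
  have U1: "y \<bullet> (?U *v y) \<le> y \<bullet> y" for y
    using transport_eig_le[OF A(1,2) aI A(3)] A(3) by (simp add: eig_le_def)
  have AUU: "A ** ?U ** ?U = a *\<^sub>R mat 1"
  proof -
    have "?U ** ((1 / a) *\<^sub>R (A ** ?U)) = mat 1"
      using transport_pushforward[OF A(1) aI(1)] A(3) by (simp add: matrix_distribs matrix_mul_assoc)
    then have "((1 / a) *\<^sub>R (A ** ?U)) ** ?U = mat 1" by (metis matrix_left_right_inverse)
    then have "(1 / a) *\<^sub>R (A ** ?U ** ?U) = mat 1" by (simp add: matrix_distribs)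
    then have "a *\<^sub>R ((1 / a) *\<^sub>R (A ** ?U ** ?U)) = a *\<^sub>R mat 1" by simp
    then show ?thesis using A(3) by simp
  qed
  show "a * (x \<bullet> x) \<le> x \<bullet> ((S ** A ** S) *v x)"
  proof (cases "x = 0")
    case False
    define n m s u q where "n = x \<bullet> x" and "m = x \<bullet> (?U *v x)" and "s = x \<bullet> (S *v x)"
      and "u = (?U *v x) \<bullet> (?U *v x)" and "q = (S *v x) \<bullet> (A *v (S *v x))"
    have n: "0 < n" using False by (simp add: n_def)
    have m: "0 < m" "m \<le> n" using spd_pos[OF U False] U1 by (auto simp: m_def n_def)
    have "?U *v x \<noteq> 0" using spd_kernel[OF U] False by blast
    then have u: "0 < u" by (simp add: u_def)
    have um: "u \<le> m"
    proof -
      have "u\<^sup>2 \<le> m * ((?U *v x) \<bullet> (?U *v (?U *v x)))"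
        using psd_cauchy_schwarz[OF spd_psd[OF U], of x "?U *v x"]
        by (simp add: u_def m_def sym_dot[OF sU, of x])
      also have "\<dots> \<le> m * u" unfolding u_def using m U1 by (intro mult_left_mono) auto
      finally show ?thesis using u by (simp add: power2_eq_square)
    qed
    have s: "(1 - \<eta>) * n + \<eta> * m \<le> s"
    proof -
      have "s = (1 - \<eta>) * n + \<eta> * (x \<bullet> (G *v x))"
        by (simp add: s_def S_def n_def matrix_vector_mult_add_rdistrib
            scaleR_matrix_vector_assoc[symmetric] inner_add_right)
      then show ?thesis using G[of x] \<eta> by (simp add: m_def mult_left_mono)
    qed
    define z where "z = (1 / a) *\<^sub>R (?U *v (?U *v x))"
    have Az: "A *v z = x"
      using AUU A(3)
      by (simp add: z_def matrix_vector_mult_scaleR matrix_vector_mul_assoc scaleR_matrix_vector_assoc[symmetric]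
          matrix_mul_assoc)
    have zx: "z \<bullet> x = u / a"
      using sym_dot[OF sU, of x "?U *v x"] by (simp add: z_def u_def inner_commute)
    have "s\<^sup>2 \<le> q * (u / a)"
      using psd_cauchy_schwarz[OF spd_psd[OF A(1)], of "S *v x" z]
      by (simp add: Az zx[symmetric] s_def q_def inner_commute)
    then have "a * s\<^sup>2 \<le> q * u" using A(3) by (simp add: field_simps)
    also have "\<dots> \<le> q * m"
      using um spd_psd[OF A(1)] by (intro mult_left_mono) (auto simp: q_def psd_def)
    finally have 1: "a * s\<^sup>2 \<le> q * m" .
    have "n * m \<le> ((1 - \<eta>) * n + \<eta> * m)\<^sup>2"
    proof -
      have "\<eta>\<^sup>2 * m \<le> (1 - \<eta>)\<^sup>2 * n" using m n \<eta> by (intro mult_mono power_mono) auto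
      then have "0 \<le> (n - m) * ((1 - \<eta>)\<^sup>2 * n - \<eta>\<^sup>2 * m)" using m by simp
      then show ?thesis by (simp add: power2_eq_square algebra_simps)
    qed
    also have "\<dots> \<le> s\<^sup>2" using s n m \<eta> by (intro power_mono) auto
    finally have "a * (n * m) \<le> q * m" using 1 A(3) by (smt (verit) mult_left_mono)
    then have "a * n \<le> q" using m by simp
    then show ?thesis by (simp add: congruence_quadratic_form[OF sS] q_def n_def)
  qed simp
qed

section \<open>Measurability of the transport map\<close>

lemma continuous_on_matrix_mul:
  fixes f :: "'a::topological_space \<Rightarrow> real^'n^'m" and g :: "'a \<Rightarrow> real^'p^'n"
  assumes "continuous_on S f" "continuous_on S g"
  shows "continuous_on S (\<lambda>x. f x ** g x)"
  unfolding matrix_matrix_mult_def using assms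
  by (intro continuous_intros continuous_on_component) auto

lemma continuous_on_transpose:
  fixes f :: "'a::topological_space \<Rightarrow> real^'n^'m"
  assumes "continuous_on S f" shows "continuous_on S (\<lambda>x. transpose (f x))"
  unfolding transpose_def using assms
  by (intro continuous_intros continuous_on_component)

lemma borel_measurable_matrix_mul:
  fixes f :: "'a \<Rightarrow> real^'n^'m" and g :: "'a \<Rightarrow> real^'p^'n"
  assumes "f \<in> borel_measurable M" "g \<in> borel_measurable M"
  shows "(\<lambda>x. f x ** g x) \<in> borel_measurable M"
  by (rule borel_measurable_continuous_Pair[OF assms])
    (intro continuous_on_matrix_mul continuous_intros)

definition spectral_box :: "real \<Rightarrow> real \<Rightarrow> (real^'n^'n) set" where
  "spectral_box a b = {A. transpose A = A \<and> eig_ge A a \<and> eig_le A b}"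

lemma closed_symmetric: "closed {A :: real^'n^'n. transpose A = A}"
  by (intro closed_Collect_eq continuous_on_transpose continuous_intros)

lemma closed_eig_ge: "closed {A :: real^'n^'n. eig_ge A a}"
  unfolding eig_ge_def inner_outer[symmetric]
  by (intro closed_Collect_all closed_Collect_le continuous_intros)

lemma closed_eig_le: "closed {A :: real^'n^'n. eig_le A a}"
  unfolding eig_le_def inner_outer[symmetric]
  by (intro closed_Collect_all closed_Collect_le continuous_intros)

lemma closed_spectral_box: "closed (spectral_box a b)"
  unfolding spectral_box_def
  by (intro closed_Collect_conj closed_symmetric closed_eig_ge closed_eig_le)

lemma closed_psd: "closed {A :: real^'n^'n. psd A}"
  unfolding psd_def inner_outer[symmetric]
  by (intro closed_Collect_conj closed_symmetric closed_Collect_all closed_Collect_le continuous_intros)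

lemma spectral_box_spd: "0 < a \<Longrightarrow> A \<in> spectral_box a b \<Longrightarrow> A \<in> spd_matrices"
  unfolding spectral_box_def by (auto intro: eig_ge_spd)

lemma trace_le_of_eig_le:
  fixes A :: "real^'n^'n"
  assumes "eig_le A b" shows "trace A \<le> real CARD('n) * b"
proof -
  have "A $ i $ i \<le> b" for i
  proof -
    have "axis i 1 \<bullet> (A *v axis i 1) \<le> b * (axis i 1 \<bullet> axis i (1::real))"
      using assms unfolding eig_le_def by blast
    then show ?thesis by (simp add: matrix_vector_mult_basis inner_axis' inner_axis_axis column_def)
  qed
  then have "trace A \<le> (\<Sum>i\<in>(UNIV :: 'n set). b)" unfolding trace_def by (intro sum_mono)
  then show ?thesis by simp
qed

text \<open>The cost \<open>T \<bullet> (T ** A)\<close> of the map itself is the trace of its target \<open>B\<close>.\<close>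

lemma transport_norm_bound:
  fixes A B :: "real^'n^'n"
  assumes A: "A \<in> spd_matrices" "eig_ge A a" and B: "B \<in> spd_matrices" "eig_le B b"
    and a: "0 < a"
  shows "norm (transport A B) \<le> sqrt (real CARD('n) * b / a)"
proof -
  let ?T = "transport A B"
  have T: "?T \<in> spd_matrices" by (rule transport_spd[OF A(1) B(1)])
  have "a * (?T \<bullet> ?T) \<le> ?T \<bullet> (?T ** A)" by (rule weighted_inner_ge[OF spd_sym[OF A(1)] A(2)])
  also have "\<dots> = trace B"
    using transport_pushforward[OF A(1) B(1)] spd_sym[OF T]
    unfolding inner_matrix_eq_trace by (metis trace_mul_sym)
  also have "\<dots> \<le> real CARD('n) * b" by (rule trace_le_of_eig_le[OF B(2)])
  finally have "?T \<bullet> ?T \<le> real CARD('n) * b / a" using a by (simp add: field_simps)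
  then show ?thesis by (simp add: norm_eq_sqrt_inner)
qed

text \<open>On a box of spectral bounds the transport map takes values in a ball, and its graph is cut
  out by the closed conditions that determine it uniquely.\<close>

lemma continuous_on_transport:
  assumes a: "0 < a"
  shows "continuous_on (spectral_box a b \<times> spectral_box a b)
    (\<lambda>(A, B). transport A (B :: real^'n^'n))"
proof (rule continuous_from_closed_graph)
  let ?S = "spectral_box a b \<times> (spectral_box a b :: (real^'n^'n) set)"
  show "compact (cball 0 (sqrt (real CARD('n) * b / a)) :: (real^'n^'n) set)" by (rule compact_cball)
  have box: "A \<in> spd_matrices \<and> eig_ge A a \<and> eig_le A b" if "A \<in> spectral_box a b" for A :: "real^'n^'n"
    using spectral_box_spd[OF a that] that by (simp add: spectral_box_def)
  show "(\<lambda>(A, B). transport A B) \<in> ?S \<rightarrow> cball 0 (sqrt (real CARD('n) * b / a))"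
  proof safe
    fix A B :: "real^'n^'n" assume "A \<in> spectral_box a b" "B \<in> spectral_box a b"
    with box have "norm (transport A B) \<le> sqrt (real CARD('n) * b / a)"
      by (intro transport_norm_bound a) auto
    then show "transport A B \<in> cball 0 (sqrt (real CARD('n) * b / a))" by simp
  qed
  have "(\<lambda>x. (x, case x of (A, B) \<Rightarrow> transport A B)) ` ?S =
    (\<lambda>z. fst (fst z)) -` spectral_box a b \<inter> (\<lambda>z. snd (fst z)) -` spectral_box a b \<inter> snd -` {X. psd X}
      \<inter> {z. snd z ** fst (fst z) ** snd z = snd (fst z)}" (is "?L = ?R")
  proof
    have "psd (transport A B) \<and> transport A B ** A ** transport A B = B"
      if "A \<in> spectral_box a b" "B \<in> spectral_box a b" for A B :: "real^'n^'n"
      using box[OF that(1)] box[OF that(2)] by (metis spd_psd transport_spd transport_pushforward)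
    then show "?L \<subseteq> ?R" by auto
    show "?R \<subseteq> ?L"
    proof
      fix z assume z: "z \<in> ?R"
      obtain A B X where zz: "z = ((A, B), X)" by (metis surj_pair)
      have "X = transport A B" using z box by (intro transport_unique) (auto simp: zz)
      then show "z \<in> ?L" using z zz by force
    qed
  qed
  moreover have "closed ?R"
    by (intro closed_Int closed_vimage closed_Collect_eq continuous_on_matrix_mul continuous_intros
        closed_spectral_box closed_psd)
  ultimately show "closed ((\<lambda>x. (x, case x of (A, B) \<Rightarrow> transport A B)) ` ?S)" by simp
qed

abbreviation borel_spd :: "(real^'n^'n) measure" where
  "borel_spd \<equiv> restrict_space borel spd_matrices"

lemma spd_spectral_bounds:
  assumes "(A :: real^'n^'n) \<in> spd_matrices"
  obtains a b where "0 < a" "eig_ge A a" "eig_le A b"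
proof -
  from min_eigenvector[OF spd_sym[OF assms]] obtain v \<mu> where
    v: "norm v = 1" "A *v v = \<mu> *\<^sub>R v" "\<And>x. \<mu> * (x \<bullet> x) \<le> x \<bullet> (A *v x)" by blast
  from max_eigenvector[OF spd_sym[OF assms]] obtain w \<nu> where
    w: "\<And>x. x \<bullet> (A *v x) \<le> \<nu> * (x \<bullet> x)" by metis
  have "v \<noteq> 0" "v \<bullet> v = 1" using v by (auto simp: dot_square_norm)
  then have "0 < \<mu>" using spd_pos[OF assms, of v] v by simp
  with v w show thesis by (intro that[of \<mu> \<nu>]) (auto simp: eig_ge_def eig_le_def)
qed

lemma spd_eq_UN_boxes:
  "spd_matrices = (\<Union>n. spectral_box (1 / real (Suc n)) (real (Suc n)) :: (real^'n^'n) set)"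
proof
  show "(\<Union>n. spectral_box (1 / real (Suc n)) (real (Suc n))) \<subseteq> (spd_matrices :: (real^'n^'n) set)"
  proof (rule UN_least)
    show "spectral_box (1 / real (Suc n)) (real (Suc n)) \<subseteq> (spd_matrices :: (real^'n^'n) set)" for n
      by (rule subsetI, rule spectral_box_spd) auto
  qed
  show "(spd_matrices :: (real^'n^'n) set) \<subseteq> (\<Union>n. spectral_box (1 / real (Suc n)) (real (Suc n)))"
  proof
    fix A :: "real^'n^'n" assume A: "A \<in> spd_matrices"
    from spd_spectral_bounds[OF A] obtain a b where ab: "0 < a" "eig_ge A a" "eig_le A b" by blast
    obtain n :: nat where n: "max (1 / a) b \<le> real n" using real_arch_simple by blast
    have "1 / real (Suc n) \<le> a"
    proof -
      have "1 / a \<le> real (Suc n)" using n by simp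
      then show ?thesis using ab by (simp add: field_simps)
    qed
    moreover have "b \<le> real (Suc n)" using n by simp
    ultimately have "A \<in> spectral_box (1 / real (Suc n)) (real (Suc n))"
      using ab(2,3) spd_sym[OF A] eig_ge_mono eig_le_mono unfolding spectral_box_def by blast
    then show "A \<in> (\<Union>n. spectral_box (1 / real (Suc n)) (real (Suc n)))" by blast
  qed
qed

lemma spectral_box_mono: "a' \<le> a \<Longrightarrow> b \<le> b' \<Longrightarrow> spectral_box a b \<subseteq> spectral_box a' b'"
  unfolding spectral_box_def using eig_ge_mono eig_le_mono by blast

text \<open>The boxes \<open>spectral_box (1 / n) n\<close> exhaust the positive definite matrices, and the map is
  continuous on each of their squares.\<close>

lemma measurable_transport_pair:
  "(\<lambda>(A, B). transport A (B :: real^'n^'n)) \<in> borel_measurable (borel_spd \<Otimes>\<^sub>M borel_spd)"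
proof (rule measurable_piecewise_restrict)
  let ?M = "borel_spd \<Otimes>\<^sub>M borel_spd :: ((real^'n^'n) \<times> (real^'n^'n)) measure"
  let ?b = "\<lambda>n. spectral_box (1 / real (Suc n)) (real (Suc n)) :: (real^'n^'n) set"
  let ?C = "\<lambda>n. ?b n \<times> ?b n"
  have sp: "space ?M = spd_matrices \<times> spd_matrices" by (simp add: space_pair_measure space_restrict_space)
  show "countable (range ?C)" by simp
  have idm: "(\<lambda>x. x) \<in> measurable ?M borel"
  proof -
    have [measurable]: "(\<lambda>A. A) \<in> measurable borel_spd (borel :: (real^'n^'n) measure)"
      by (rule measurable_restrict_space1) simp
    have "(\<lambda>x. (fst x, snd x)) \<in> measurable ?M (borel \<Otimes>\<^sub>M borel)"
      by (intro measurable_Pair measurable_compose[OF measurable_fst] measurable_compose[OF measurable_snd]) auto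
    then show ?thesis by (simp add: borel_prod)
  qed
  have closed: "closed (?C n)" for n by (intro closed_Times closed_spectral_box)
  show "\<Omega> \<inter> space ?M \<in> sets ?M" if "\<Omega> \<in> range ?C" for \<Omega>
    using that measurable_sets[OF idm, of \<Omega>] closed by auto
  show "space ?M \<subseteq> \<Union> (range ?C)"
  proof
    fix z assume z: "z \<in> space ?M"
    then obtain m n where mn: "fst z \<in> ?b m" "snd z \<in> ?b n"
      unfolding sp by (auto simp: spd_eq_UN_boxes)
    have le: "?b k \<subseteq> ?b (max m n)" if "k \<le> max m n" for k
      using that by (intro spectral_box_mono) (auto simp: frac_le)
    have "z \<in> ?C (max m n)" using mn le[of m] le[of n] by (auto simp: mem_Times_iff)
    then show "z \<in> \<Union> (range ?C)" by blast
  qed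
  fix \<Omega> assume "\<Omega> \<in> range ?C"
  then obtain n where \<Omega>: "\<Omega> = ?C n" by blast
  have "(\<lambda>x. x) \<in> measurable (restrict_space ?M \<Omega>) (restrict_space borel \<Omega>)"
    by (rule measurable_restrict_space3[OF idm]) auto
  moreover have "(\<lambda>(A, B). transport A B) \<in> borel_measurable (restrict_space borel \<Omega>)"
    unfolding \<Omega> by (intro borel_measurable_continuous_on_restrict continuous_on_transport) simp
  ultimately show "(\<lambda>(A, B). transport A B) \<in> borel_measurable (restrict_space ?M \<Omega>)"
    by (rule measurable_compose)
qed

lemma measurable_spd_borel: "f \<in> measurable M borel_spd \<Longrightarrow> f \<in> borel_measurable M"
  by (rule measurable_restrict_space2_iff[THEN iffD1, THEN conjunct1])

lemma measurable_transport:
  assumes f: "f \<in> measurable M borel_spd" and g: "g \<in> measurable M borel_spd"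
  shows "(\<lambda>x. transport (f x) (g x :: real^'n^'n)) \<in> borel_measurable M"
  using measurable_compose[OF measurable_Pair[OF f g] measurable_transport_pair] by simp

lemma measurable_trace: "f \<in> borel_measurable M \<Longrightarrow> (\<lambda>x. trace (f x :: real^'n^'n)) \<in> borel_measurable M"
  unfolding trace_eq_inner by simp

lemma measurable_W2_sq:
  assumes f: "f \<in> measurable M borel_spd" and g: "g \<in> measurable M borel_spd"
  shows "(\<lambda>x. W2_sq (f x) (g x :: real^'n^'n)) \<in> borel_measurable M"
proof -
  have spd: "f x \<in> spd_matrices" "g x \<in> spd_matrices" if "x \<in> space M" for x
    using measurable_space[OF f that] measurable_space[OF g that] by (auto simp: space_restrict_space)
  have "(\<lambda>x. trace (f x) + trace (g x) - 2 * trace (transport (f x) (g x) ** f x)) \<in> borel_measurable M"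
    using measurable_spd_borel[OF f] measurable_spd_borel[OF g] measurable_transport[OF f g]
    by (intro borel_measurable_add borel_measurable_diff borel_measurable_times measurable_trace
        borel_measurable_matrix_mul) auto
  then show ?thesis
    by (subst measurable_cong[where g="\<lambda>x. trace (f x) + trace (g x) - 2 * trace (transport (f x) (g x) ** f x)"])
      (simp_all add: W2_sq_transport spd)
qed

section \<open>The barycenter functional\<close>

locale bounded_spd_prob =
  fixes P :: "(real^'n^'n) measure" and lmin lmax \<kappa> :: real
  assumes spd_prob: "spd_prob P"
    and lmin: "0 < lmin" and lmin_le_lmax: "lmin \<le> lmax"
    and \<kappa>: "\<kappa> = lmax / lmin"
    and AE_eigenvalues: "AE B in P. \<forall>l. is_eigenvalue B l \<longrightarrow> lmin \<le> l \<and> l \<le> lmax"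
begin

lemma prob_space_P: "prob_space P" and sets_P: "sets P = sets borel_spd"
  using spd_prob by (auto simp: spd_prob_def)

sublocale prob_space P by (rule prob_space_P)

lemma lmax: "0 < lmax" using lmin lmin_le_lmax by simp

lemma \<kappa>_ge_1: "1 \<le> \<kappa>" using lmin lmin_le_lmax by (simp add: \<kappa>)

lemma space_P: "space P = spd_matrices"
  using sets_eq_imp_space_eq[OF sets_P] by (simp add: space_restrict_space)

lemma measurable_P_iff: "measurable M P = measurable M borel_spd"
  by (rule measurable_cong_sets) (simp_all add: sets_P)

abbreviation spd_box :: "(real^'n^'n) set" where "spd_box \<equiv> spectral_box lmin lmax"

lemma box_spd: "A \<in> spd_box \<Longrightarrow> A \<in> spd_matrices"
  by (rule spectral_box_spd[OF lmin])

lemma AE_box: "AE B in P. B \<in> spd_box"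
  using AE_eigenvalues AE_space
proof eventually_elim
  case (elim B)
  then show ?case
    using eigenvalues_eig_bounds[of B lmin lmax] spd_sym[of B] by (auto simp: space_P spectral_box_def)
qed

lemma measure_support_box:
  assumes "A \<in> measure_support P" shows "A \<in> spd_box"
proof (rule ccontr)
  assume "A \<notin> spd_box"
  moreover have "open (- spd_box)" by (rule open_Compl[OF closed_spectral_box])
  ultimately have "0 < emeasure P (- spd_box \<inter> space P)"
    using assms by (auto simp: measure_support_def)
  moreover have "emeasure P (- spd_box \<inter> space P) = 0"
  proof -
    have "emeasure P {B \<in> space P. \<not> B \<in> spd_box} = 0"
    proof (rule AE_E[OF AE_box])
      fix N assume N: "{B \<in> space P. \<not> B \<in> spd_box} \<subseteq> N" "emeasure P N = 0" "N \<in> sets P"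
      show ?thesis using emeasure_mono[OF N(1,3)] N(2) by simp
    qed
    moreover have "- spd_box \<inter> space P = {B \<in> space P. \<not> B \<in> spd_box}" by auto
    ultimately show ?thesis by simp
  qed
  ultimately show False by simp
qed

lemma measurable_ident_P: "(\<lambda>B. B) \<in> measurable P borel_spd"
  using measurable_ident_sets[OF sets_P] by (simp add: id_def)

lemma measurable_transport_P:
  assumes "A \<in> spd_matrices" shows "(\<lambda>B. transport A B) \<in> borel_measurable P"
  by (intro measurable_transport measurable_ident_P measurable_const)
    (simp add: space_restrict_space assms)

lemma integrable_transport:
  assumes A: "A \<in> spd_matrices" shows "integrable P (\<lambda>B. transport A B)"
proof -
  from spd_spectral_bounds[OF A] obtain a b where a: "0 < a" "eig_ge A a" by blast
  have "AE B in P. norm (transport A B) \<le> sqrt (real CARD('n) * lmax / a)"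
    using AE_box
  proof eventually_elim
    case (elim B)
    then show ?case using box_spd[OF elim]
      by (intro transport_norm_bound A a) (auto simp: spectral_box_def)
  qed
  then show ?thesis using measurable_transport_P[OF A]
    by (intro integrable_const_bound) auto
qed

lemma integrable_P_ident: "integrable P (\<lambda>B. B)"
proof -
  have "AE B in P. norm B \<le> sqrt (real CARD('n) * lmax / 1 * lmax)"
    using AE_box
  proof eventually_elim
    case (elim B)
    have B: "transpose B = B" "eig_le B lmax" "B \<in> spd_matrices"
      using elim box_spd[OF elim] by (auto simp: spectral_box_def)
    note R = msqrt_square[OF spd_psd[OF B(3)]] spd_sym[OF spd_msqrt[OF B(3)]]
    have comm: "B ** msqrt B = msqrt B ** B" by (metis R(1) matrix_mul_assoc)
    have "B \<bullet> B = msqrt B \<bullet> (msqrt B ** B)"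
      using inner_matrix_mul_right[of "msqrt B" "msqrt B" B] by (simp add: R comm)
    also have "\<dots> \<le> lmax * (msqrt B \<bullet> msqrt B)" by (rule weighted_inner_le[OF B(1,2)])
    also have "msqrt B \<bullet> msqrt B = trace B"
      using msqrt_square[OF spd_psd[OF B(3)]] spd_sym[OF spd_msqrt[OF B(3)]] by (simp add: inner_matrix_eq_trace)
    also have "lmax * \<dots> \<le> lmax * (real CARD('n) * lmax)"
      using lmax by (intro mult_left_mono trace_le_of_eig_le B) auto
    finally show ?case by (simp add: norm_eq_sqrt_inner mult_ac)
  qed
  then show ?thesis using measurable_spd_borel[OF measurable_ident_P]
    by (intro integrable_const_bound) auto
qed

lemma integrable_W2_sq:
  assumes A: "A \<in> spd_matrices" shows "integrable P (\<lambda>B. W2_sq A B)"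
proof -
  have "integrable P (\<lambda>B. trace A + mat 1 \<bullet> B - 2 * (transport A B \<bullet> A))"
    using integrable_P_ident integrable_transport[OF A] by (intro Bochner_Integration.integrable_add Bochner_Integration.integrable_diff
        Bochner_Integration.integrable_mult_right Bochner_Integration.integrable_inner_left integrable_inner_right integrable_const) auto
  moreover have "W2_sq A B = trace A + mat 1 \<bullet> B - 2 * (transport A B \<bullet> A)" if "B \<in> space P" for B
  proof -
    have B: "B \<in> spd_matrices" using that by (simp add: space_P)
    show ?thesis using W2_sq_transport[OF A B] spd_sym[OF transport_spd[OF A B]]
      by (simp add: trace_eq_inner[of B] inner_matrix_eq_trace[of "transport A B" A])
  qed
  ultimately show ?thesis by (subst Bochner_Integration.integrable_cong[OF refl]) auto
qed

abbreviation F :: "real^'n^'n \<Rightarrow> real" where "F \<equiv> barycenter_functional P"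

lemma integral_W2_sq: "(\<integral>B. W2_sq A B \<partial>P) = 2 * F A"
  by (simp add: barycenter_functional_def)

definition mean_transport :: "real^'n^'n \<Rightarrow> real^'n^'n" where
  "mean_transport A = (\<integral>B. transport A B \<partial>P)"

lemma mean_transport_inner:
  assumes "A \<in> spd_matrices" shows "mean_transport A \<bullet> X = (\<integral>B. transport A B \<bullet> X \<partial>P)"
  unfolding mean_transport_def by (rule integral_inner_left[symmetric]) (rule integrable_transport[OF assms])

lemma mean_transport_inner_le:
  assumes A: "A \<in> spd_matrices" and le: "\<And>B. B \<in> spd_box \<Longrightarrow> transport A B \<bullet> X \<le> c"
  shows "mean_transport A \<bullet> X \<le> c"
proof -
  have "(\<integral>B. transport A B \<bullet> X \<partial>P) \<le> (\<integral>B. c \<partial>P)"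
    using AE_box by (intro integral_mono_AE Bochner_Integration.integrable_inner_left integrable_transport A integrable_const)
      (auto intro: le)
  then show ?thesis by (simp add: mean_transport_inner[OF A] prob_space)
qed

lemma mean_transport_sym:
  assumes A: "A \<in> spd_matrices" shows "transpose (mean_transport A) = mean_transport A"
proof -
  have "(transpose (mean_transport A) - mean_transport A) \<bullet> X = 0" for X
  proof -
    have "mean_transport A \<bullet> transpose X = mean_transport A \<bullet> X"
      unfolding mean_transport_inner[OF A]
    proof (rule Bochner_Integration.integral_cong[OF refl])
      fix B assume "B \<in> space P"
      then have "transpose (transport A B) = transport A B"
        using transport_spd[OF A] spd_sym by (auto simp: space_P)
      then show "transport A B \<bullet> transpose X = transport A B \<bullet> X" by (metis inner_transpose)
    qed
    then show ?thesis using inner_transpose[of "mean_transport A" "transpose X"]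
      by (simp add: inner_diff_left)
  qed
  then show ?thesis by (metis inner_eq_zero_iff right_minus_eq)
qed

lemma mean_transport_ge:
  assumes A: "A \<in> spd_matrices" and le: "\<And>B. B \<in> spd_box \<Longrightarrow> c \<le> x \<bullet> (transport A B *v x)"
  shows "c \<le> x \<bullet> (mean_transport A *v x)"
proof -
  have "mean_transport A \<bullet> (- outer x x) \<le> - c"
    by (intro mean_transport_inner_le A) (simp add: inner_outer le)
  then show ?thesis by (simp add: inner_outer)
qed

lemma transport_box_ge:
  assumes A: "A \<in> spd_matrices" "eig_le A lmax" and B: "B \<in> spd_box"
  shows "eig_ge (transport A B) (1 / sqrt \<kappa>)"
proof -
  have "eig_ge (transport A B) (sqrt (lmin / lmax))"
    using B lmin lmax by (intro transport_eig_ge A box_spd) (auto simp: spectral_box_def)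
  then show ?thesis by (simp add: \<kappa> real_sqrt_divide)
qed

lemma mean_transport_spd:
  assumes A: "A \<in> spd_matrices" shows "mean_transport A \<in> spd_matrices"
proof -
  from spd_spectral_bounds[OF A] obtain a b where b: "eig_le A b" by blast
  let ?b = "max b 1"
  have b': "eig_le A ?b" using eig_le_mono[OF b] by simp
  have "eig_ge (mean_transport A) (sqrt (lmin / ?b))"
    unfolding eig_ge_def
  proof
    fix x
    show "sqrt (lmin / ?b) * (x \<bullet> x) \<le> x \<bullet> (mean_transport A *v x)"
    proof (rule mean_transport_ge[OF A])
      fix B assume B: "B \<in> spd_box"
      have "eig_ge (transport A B) (sqrt (lmin / ?b))"
        using B lmin by (intro transport_eig_ge A b' box_spd) (auto simp: spectral_box_def)
      then show "sqrt (lmin / ?b) * (x \<bullet> x) \<le> x \<bullet> (transport A B *v x)" by (simp add: eig_ge_def)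
    qed
  qed
  moreover have "0 < sqrt (lmin / ?b)" using lmin by simp
  ultimately show ?thesis by (rule eig_ge_spd[OF mean_transport_sym[OF A]])
qed

lemma F_nonneg: "A \<in> spd_matrices \<Longrightarrow> 0 \<le> F A"
  unfolding barycenter_functional_def
  by (intro mult_nonneg_nonneg integral_nonneg_AE AE_I2) (auto simp: space_P W2_sq_nonneg)

text \<open>If \<open>T\<close> is optimal from \<open>A\<close> to \<open>B\<close>, then \<open>T ** matrix_inv S\<close> is a coupling of \<open>S ** A ** S\<close> with
  \<open>B\<close>; its cost is the squared distance of \<open>T\<close> from \<open>S\<close> in the inner product weighted by \<open>A\<close>.\<close>

lemma W2_sq_step_le:
  assumes A: "A \<in> spd_matrices" and B: "B \<in> spd_matrices" and S: "S \<in> spd_matrices"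
  shows "W2_sq (S ** A ** S) B \<le> W2_sq A B
    - 2 * ((S - mat 1) \<bullet> ((transport A B - mat 1) ** A)) + (S - mat 1) \<bullet> ((S - mat 1) ** (A :: real^'n^'n))"
proof -
  let ?T = "transport A B" and ?J = "matrix_inv S"
  have T: "?T \<in> spd_matrices" by (rule transport_spd[OF A B])
  note sA = spd_sym[OF A] and sS = spd_sym[OF S] and sT = spd_sym[OF T] and sJ = spd_sym[OF spd_inv[OF S]]
  have SAS: "S ** A ** S \<in> spd_matrices" by (rule spd_congruence_spd[OF A S])
  have JS: "?J ** S = mat 1" "S ** ?J = mat 1" using spd_inv_left[OF S] spd_inv_right[OF S] .
  have "(?T ** ?J) ** (S ** A ** S) ** transpose (?T ** ?J) = ?T ** (?J ** S) ** A ** (S ** ?J) ** ?T"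
    by (simp add: matrix_transpose_mul sT sJ matrix_mul_assoc)
  also have "\<dots> = B" by (simp add: JS transport_pushforward[OF A B])
  finally have "W2_sq (S ** A ** S) B \<le> (?T ** ?J - mat 1) \<bullet> ((?T ** ?J - mat 1) ** (S ** A ** S))"
    by (intro W2_sq_le_coupling SAS B)
  also have "\<dots> = ((?T ** ?J - mat 1) ** S) \<bullet> (((?T ** ?J - mat 1) ** S) ** A)"
    by (simp add: inner_matrix_mul_right sS matrix_mul_assoc)
  also have "(?T ** ?J - mat 1) ** S = (?T - mat 1) - (S - mat 1)"
    by (simp add: matrix_distribs matrix_mul_assoc[symmetric] JS)
  also have "((?T - mat 1) - (S - mat 1)) \<bullet> (((?T - mat 1) - (S - mat 1)) ** A)
      = (?T - mat 1) \<bullet> ((?T - mat 1) ** A) - (?T - mat 1) \<bullet> ((S - mat 1) ** A)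
        - (S - mat 1) \<bullet> ((?T - mat 1) ** A) + (S - mat 1) \<bullet> ((S - mat 1) ** A)"
    by (simp only: matrix_mul_diff_left[of "?T - mat 1" "S - mat 1" A] inner_diff_left[of "?T - mat 1"]
        inner_diff_right[of _ "(?T - mat 1) ** A"])
  also have "(?T - mat 1) \<bullet> ((S - mat 1) ** A) = (S - mat 1) \<bullet> ((?T - mat 1) ** A)"
    using inner_matrix_mul_right[of "S - mat 1" A "?T - mat 1"] by (simp add: sA inner_commute)
  finally show ?thesis by (simp add: W2_sq_eq_weighted[OF A B])
qed

lemma F_step_le:
  assumes A: "A \<in> spd_matrices" and S: "S \<in> spd_matrices"
  shows "F (S ** A ** S) \<le> F A - (S - mat 1) \<bullet> ((mean_transport A - mat 1) ** A)
    + 1 / 2 * ((S - mat 1) \<bullet> ((S - mat 1) ** A))"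
proof -
  let ?q = "(S - mat 1) \<bullet> ((S - mat 1) ** A)"
  let ?X = "(S - mat 1) ** A"
  have SAS: "S ** A ** S \<in> spd_matrices" by (rule spd_congruence_spd[OF A S])
  have move: "(S - mat 1) \<bullet> ((Z - mat 1) ** A) = Z \<bullet> ?X - mat 1 \<bullet> ?X" for Z :: "real^'n^'n"
  proof -
    have "(S - mat 1) \<bullet> ((Z - mat 1) ** A) = (Z - mat 1) \<bullet> ?X"
      using inner_matrix_mul_right[of "S - mat 1" A "Z - mat 1"] by (simp add: spd_sym[OF A] inner_commute)
    then show ?thesis by (simp only: inner_diff_left)
  qed
  have int: "integrable P (\<lambda>B. transport A B \<bullet> ?X)"
    by (intro Bochner_Integration.integrable_inner_left integrable_transport A)
  have "(\<integral>B. W2_sq (S ** A ** S) B \<partial>P)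
      \<le> (\<integral>B. W2_sq A B - 2 * (transport A B \<bullet> ?X - mat 1 \<bullet> ?X) + ?q \<partial>P)"
    using W2_sq_step_le[OF A _ S] unfolding move
    by (intro integral_mono Bochner_Integration.integrable_add Bochner_Integration.integrable_diff Bochner_Integration.integrable_mult_right integrable_W2_sq
        A SAS int integrable_const) (auto simp: space_P)
  also have "\<dots> = (\<integral>B. W2_sq A B \<partial>P) - 2 * (mean_transport A \<bullet> ?X - mat 1 \<bullet> ?X) + ?q"
    (is "_ = ?rhs") using integrable_W2_sq[OF A] int by (simp add: mean_transport_inner[OF A] prob_space)
  finally have "2 * F (S ** A ** S) \<le> ?rhs" unfolding integral_W2_sq .
  moreover have "f' \<le> f - g + 1 / 2 * q" if "2 * f' \<le> 2 * f - 2 * g + q" for f f' g q :: real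
    using that by simp
  ultimately show ?thesis unfolding integral_W2_sq move by blast
qed

lemma F_duality:
  assumes A: "A \<in> spd_matrices" and A': "A' \<in> spd_matrices" "eig_le A' lmax"
  shows "F A' + 1 / 2 * ((mat 1 - mean_transport A') \<bullet> (A - A')) + 1 / (2 * sqrt \<kappa>) * W2_sq A A' \<le> F A"
proof -
  let ?X = "A - A'"
  have int: "integrable P (\<lambda>B. transport A' B \<bullet> ?X)"
    by (intro Bochner_Integration.integrable_inner_left integrable_transport A')
  have "(\<integral>B. W2_sq A' B + (mat 1 \<bullet> ?X - transport A' B \<bullet> ?X) + 1 / sqrt \<kappa> * W2_sq A A' \<partial>P)
    \<le> (\<integral>B. W2_sq A B \<partial>P)"
  proof (rule integral_mono_AE)
    show "integrable P (\<lambda>B. W2_sq A' B + (mat 1 \<bullet> ?X - transport A' B \<bullet> ?X) + 1 / sqrt \<kappa> * W2_sq A A')"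
      by (intro Bochner_Integration.integrable_add Bochner_Integration.integrable_diff integrable_W2_sq A' int integrable_const)
    show "integrable P (W2_sq A)" by (rule integrable_W2_sq[OF A])
    show "AE B in P. W2_sq A' B + (mat 1 \<bullet> ?X - transport A' B \<bullet> ?X) + 1 / sqrt \<kappa> * W2_sq A A' \<le> W2_sq A B"
      using AE_box
    proof eventually_elim
      case (elim B)
      show ?case
        using W2_sq_duality[OF A A'(1) box_spd[OF elim] transport_box_ge[OF A' elim]] \<kappa>_ge_1
        by (simp add: inner_diff_left)
    qed
  qed
  moreover have "(\<integral>B. W2_sq A' B + (mat 1 \<bullet> ?X - transport A' B \<bullet> ?X) + 1 / sqrt \<kappa> * W2_sq A A' \<partial>P)
    = (\<integral>B. W2_sq A' B \<partial>P) + (mat 1 \<bullet> ?X - mean_transport A' \<bullet> ?X) + 1 / sqrt \<kappa> * W2_sq A A'"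
    using integrable_W2_sq[OF A'(1)] int by (simp add: mean_transport_inner[OF A'(1)] prob_space)
  ultimately have "(\<integral>B. W2_sq A' B \<partial>P) + (mat 1 \<bullet> ?X - mean_transport A' \<bullet> ?X) + 1 / sqrt \<kappa> * W2_sq A A'
    \<le> (\<integral>B. W2_sq A B \<partial>P)" by simp
  moreover have half: "f' + 1 / 2 * d + 1 / (2 * sqrt \<kappa>) * w \<le> f"
    if "2 * f' + d + 1 / sqrt \<kappa> * w \<le> 2 * f" for f f' d w
    using that by simp
  ultimately show ?thesis
    unfolding integral_W2_sq by (intro half) (simp only: inner_diff_left)
qed

definition grad_sq :: "real^'n^'n \<Rightarrow> real" where
  "grad_sq A = (mean_transport A - mat 1) \<bullet> ((mean_transport A - mat 1) ** A)"

text \<open>The Polyak--Lojasiewicz inequality.  The duality bound based at \<open>A\<close> controls the gap by the pairing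
  of the gradient with \<open>A' - A\<close>, minus a multiple of \<open>W2_sq A' A\<close>.  With \<open>R = transport A A'\<close>, the
  difference \<open>A' - A = R ** A ** R - A\<close> factors, up to transposition, into \<open>R - 1\<close>, whose weighted
  norm is the Wasserstein distance, and \<open>R + 1\<close>, which is bounded through
  \<open>(R + 1) ** A ** (R + 1) \<le> 2 (A + A')\<close>.\<close>

lemma F_gradient_domination:
  assumes A: "A \<in> spd_box" and A': "A' \<in> spd_matrices" "eig_le A' lmax"
  shows "F A - F A' \<le> \<kappa> * sqrt \<kappa> / 2 * grad_sq A"
proof -
  have Aspd: "A \<in> spd_matrices" and Ale: "eig_le A lmax" and Age: "eig_ge A lmin"
    using A box_spd by (auto simp: spectral_box_def)
  define D where "D = mean_transport A - mat 1"
  define R where "R = transport A A'"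
  define X where "X = R - mat 1"
  define Y where "Y = D ** (R + mat 1)"
  note sA = spd_sym[OF Aspd]
  have sR: "transpose R = R" unfolding R_def by (rule spd_sym[OF transport_spd[OF Aspd A'(1)]])
  have sD: "transpose D = D" unfolding D_def by (simp add: transpose_diff mean_transport_sym[OF Aspd])
  have RAR: "R ** A ** R = A'" unfolding R_def by (rule transport_pushforward[OF Aspd A'(1)])
  have w: "X \<bullet> (X ** A) = W2_sq A' A"
    unfolding X_def R_def W2_sq_eq_weighted[OF Aspd A'(1), symmetric] by (rule W2_sq_commute[OF Aspd A'(1)])
  have DX: "D \<bullet> (A' - A) = Y \<bullet> (X ** A)"
  proof -
    have "D \<bullet> (R ** A) = D \<bullet> (A ** R)"
      by (metis inner_transpose matrix_transpose_mul sA sD sR)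
    moreover have "Y \<bullet> (X ** A) = D \<bullet> (X ** A ** (R + mat 1))"
      unfolding Y_def by (simp add: inner_matrix_mul_right transpose_add sR)
    moreover have "X ** A ** (R + mat 1) = A' - A ** R + R ** A - A"
      unfolding X_def by (simp add: matrix_distribs RAR)
    ultimately show ?thesis by (simp add: inner_add_right inner_diff_right)
  qed
  have YY: "Y \<bullet> (Y ** A) \<le> 4 * \<kappa> * (D \<bullet> (D ** A))"
  proof -
    have "Y \<bullet> (Y ** A) = D \<bullet> (D ** ((R + mat 1) ** A ** (R + mat 1)))"
      unfolding Y_def by (simp add: inner_matrix_mul_right transpose_add sR matrix_mul_assoc)
    also have "\<dots> \<le> 4 * lmax * (D \<bullet> D)"
    proof (rule weighted_inner_le)
      show "transpose ((R + mat 1) ** A ** (R + mat 1)) = (R + mat 1) ** A ** (R + mat 1)"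
        by (simp add: transpose_distribs sR sA matrix_mul_assoc)
      have sum: "(R + mat 1) ** A ** (R + mat 1) = 2 *\<^sub>R (A' + A) - (R - mat 1) ** A ** (R - mat 1)"
        by (simp add: matrix_distribs RAR scaleR_2)
      have p: "psd ((R - mat 1) ** A ** (R - mat 1))"
        using psd_congruence[OF spd_psd[OF Aspd], of "R - mat 1"] by (simp add: transpose_diff sR)
      show "eig_le ((R + mat 1) ** A ** (R + mat 1)) (4 * lmax)"
        unfolding eig_le_def
      proof
        fix x
        have "x \<bullet> (A' *v x) \<le> lmax * (x \<bullet> x)" "x \<bullet> (A *v x) \<le> lmax * (x \<bullet> x)"
          using A'(2) Ale by (auto simp: eig_le_def)
        moreover have "0 \<le> x \<bullet> (((R - mat 1) ** A ** (R - mat 1)) *v x)" using p by (simp add: psd_def)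
        ultimately show "x \<bullet> ((R + mat 1) ** A ** (R + mat 1) *v x) \<le> 4 * lmax * (x \<bullet> x)"
          unfolding sum by (simp add: matrix_vector_mult_diff_rdistrib matrix_vector_mult_add_rdistrib
              scaleR_matrix_vector_assoc[symmetric] inner_diff_right inner_add_right)
      qed
    qed
    also have "\<dots> = 4 * \<kappa> * (lmin * (D \<bullet> D))" using lmin by (simp add: \<kappa>)
    also have "\<dots> \<le> 4 * \<kappa> * (D \<bullet> (D ** A))"
      using \<kappa>_ge_1 by (intro mult_left_mono weighted_inner_ge sA Age) auto
    finally show ?thesis .
  qed
  \<comment> \<open>Young's inequality with the weight that cancels the transport term of the duality bound.\<close>
  define c where "c = sqrt \<kappa> / 2"
  have c: "0 < c" using \<kappa>_ge_1 by (simp add: c_def)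
  have "0 \<le> (c *\<^sub>R Y - X) \<bullet> ((c *\<^sub>R Y - X) ** A)"
    by (rule weighted_inner_nonneg[OF spd_psd[OF Aspd]])
  also have "\<dots> = c\<^sup>2 * (Y \<bullet> (Y ** A)) - 2 * c * (Y \<bullet> (X ** A)) + X \<bullet> (X ** A)"
  proof -
    have "X \<bullet> (Y ** A) = Y \<bullet> (X ** A)"
      using inner_matrix_mul_right[of X A Y] by (simp add: sA inner_commute)
    then show ?thesis
      by (simp add: matrix_distribs inner_diff_left inner_diff_right power2_eq_square algebra_simps)
  qed
  finally have "2 * c * (Y \<bullet> (X ** A)) \<le> c\<^sup>2 * (4 * \<kappa> * grad_sq A) + W2_sq A' A"
    using mult_left_mono[OF YY, of "c\<^sup>2"] by (simp add: w grad_sq_def D_def)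
  then have "Y \<bullet> (X ** A) \<le> (c\<^sup>2 * (4 * \<kappa> * grad_sq A) + W2_sq A' A) / (2 * c)"
    using c by (simp add: field_simps)
  also have "\<dots> = \<kappa> * sqrt \<kappa> * grad_sq A + 1 / sqrt \<kappa> * W2_sq A' A"
    using c by (simp add: c_def field_simps power2_eq_square)
  finally have "D \<bullet> (A' - A) \<le> \<kappa> * sqrt \<kappa> * grad_sq A + 1 / sqrt \<kappa> * W2_sq A' A" unfolding DX .
  moreover have "(mat 1 - mean_transport A) \<bullet> (A' - A) = - (D \<bullet> (A' - A))"
    by (simp add: D_def inner_diff_left)
  ultimately show ?thesis
    using F_duality[OF A'(1) Aspd Ale] by simp
qed

lemma grad_sq_nonneg: "A \<in> spd_matrices \<Longrightarrow> 0 \<le> grad_sq A"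
  unfolding grad_sq_def by (rule weighted_inner_nonneg[OF spd_psd])

section \<open>Iterates stay within the spectral bounds\<close>

lemma convex_step_spd:
  assumes "G \<in> spd_matrices" "0 \<le> \<eta>" "\<eta> \<le> 1"
  shows "(1 - \<eta>) *\<^sub>R mat 1 + \<eta> *\<^sub>R G \<in> (spd_matrices :: (real^'n^'n) set)"
proof (cases "\<eta> = 0")
  case False
  have "0 < x \<bullet> (((1 - \<eta>) *\<^sub>R mat 1 + \<eta> *\<^sub>R G) *v x)" if "x \<noteq> 0" for x
  proof -
    have "0 < \<eta> * (x \<bullet> (G *v x))" using spd_pos[OF assms(1) that] False assms by simp
    moreover have "0 \<le> (1 - \<eta>) * (x \<bullet> x)" using assms by simp
    ultimately show ?thesis
      by (simp add: matrix_vector_mult_add_rdistrib scaleR_matrix_vector_assoc[symmetric] inner_add_right)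
  qed
  then show ?thesis using spd_sym[OF assms(1)] by (simp add: spd_matrices_def transpose_distribs)
qed (simp add: spd_mat1)

lemma step_box:
  assumes A: "A \<in> spd_box" and G: "G \<in> spd_matrices" "eig_le (G ** A ** G) lmax"
    "\<And>x. x \<bullet> (transport A (lmin *\<^sub>R mat 1) *v x) \<le> x \<bullet> (G *v x)"
    and \<eta>: "0 \<le> \<eta>" "\<eta> \<le> 1 / 2"
  defines "S \<equiv> (1 - \<eta>) *\<^sub>R mat 1 + \<eta> *\<^sub>R G"
  shows "S ** A ** S \<in> spd_box"
proof -
  have Aspd: "A \<in> spd_matrices" and Ale: "eig_le A lmax" and Age: "eig_ge A lmin"
    using A box_spd by (auto simp: spectral_box_def)
  have "transpose S = S" unfolding S_def by (simp add: transpose_distribs spd_sym[OF G(1)])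
  then have "transpose (S ** A ** S) = S ** A ** S"
    by (simp add: matrix_transpose_mul spd_sym[OF Aspd] matrix_mul_assoc)
  then show ?thesis
    unfolding spectral_box_def mem_Collect_eq S_def using \<eta>
    by (intro conjI step_eig_ge step_eig_le Aspd spd_psd[OF Aspd] Ale Age lmin spd_sym[OF G(1)] G) auto
qed

lemma lmin_id_spd: "lmin *\<^sub>R mat 1 \<in> (spd_matrices :: (real^'n^'n) set)"
  using lmin by (auto simp: spd_matrices_def transpose_distribs scaleR_matrix_vector_assoc[symmetric])

lemma transport_ge_lmin:
  assumes A: "A \<in> spd_matrices" and B: "B \<in> spd_box"
  shows "x \<bullet> (transport A (lmin *\<^sub>R mat 1) *v x) \<le> x \<bullet> (transport A B *v x)"
  using B by (intro transport_mono A box_spd lmin_id_spd)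
    (auto simp: spectral_box_def eig_ge_def scaleR_matrix_vector_assoc[symmetric])

lemma sgd_step_box:
  assumes A: "A \<in> spd_box" and B: "B \<in> spd_box" and \<eta>: "0 \<le> \<eta>" "\<eta> \<le> 1 / 2"
  shows "sgd_step \<eta> B A \<in> spd_box"
  unfolding sgd_step_def Let_def using B
  by (intro step_box A transport_spd box_spd transport_ge_lmin \<eta>)
    (use A B in \<open>auto simp: transport_pushforward box_spd\<close>, simp add: spectral_box_def)

text \<open>Jensen's inequality for the form of \<open>A\<close>: each single transport map pushes \<open>A\<close> to a matrix below
  \<open>lmax\<close>.\<close>

lemma mean_transport_pushforward_le:
  assumes A: "A \<in> spd_matrices"
  shows "eig_le (mean_transport A ** A ** mean_transport A) lmax"
  unfolding eig_le_def
proof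
  fix x
  let ?G = "mean_transport A"
  note sG = mean_transport_sym[OF A] and sA = spd_sym[OF A]
  define y where "y = ?G *v x"
  have "?G \<bullet> outer (A *v y) x \<le> (y \<bullet> (A *v y) + lmax * (x \<bullet> x)) / 2"
  proof (rule mean_transport_inner_le[OF A])
    fix B assume B: "B \<in> spd_box"
    let ?t = "transport A B *v x"
    have "0 \<le> (y - ?t) \<bullet> (A *v (y - ?t))" using spd_psd[OF A] by (simp add: psd_def)
    moreover have "?t \<bullet> (A *v ?t) \<le> lmax * (x \<bullet> x)"
      using B congruence_quadratic_form[OF spd_sym[OF transport_spd[OF A box_spd[OF B]]], of x A]
      by (simp add: transport_pushforward[OF A box_spd[OF B]] spectral_box_def eig_le_def) metis
    moreover have "?t \<bullet> (A *v y) = y \<bullet> (A *v ?t)" using sym_dot[OF sA, of ?t y] by (simp add: inner_commute)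
    moreover have "transport A B \<bullet> outer (A *v y) x = ?t \<bullet> (A *v y)" by (simp add: inner_outer inner_commute)
    ultimately show "transport A B \<bullet> outer (A *v y) x \<le> (y \<bullet> (A *v y) + lmax * (x \<bullet> x)) / 2"
      by (simp add: matrix_vector_mult_diff_distrib inner_diff_left inner_diff_right)
  qed
  moreover have "?G \<bullet> outer (A *v y) x = y \<bullet> (A *v y)" by (simp add: inner_outer y_def inner_commute)
  ultimately show "x \<bullet> (?G ** A ** ?G *v x) \<le> lmax * (x \<bullet> x)"
    by (simp add: congruence_quadratic_form[OF sG] y_def)
qed

lemma gd_step_eq: "gd_step P \<eta> A = (let S = (1 - \<eta>) *\<^sub>R mat 1 + \<eta> *\<^sub>R mean_transport A in S ** A ** S)"
  by (simp add: gd_step_def mean_transport_def)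

lemma gd_step_box:
  assumes A: "A \<in> spd_box" and \<eta>: "0 \<le> \<eta>" "\<eta> \<le> 1 / 2"
  shows "gd_step P \<eta> A \<in> spd_box"
  unfolding gd_step_eq Let_def
  by (intro step_box A mean_transport_spd box_spd mean_transport_ge transport_ge_lmin
      mean_transport_pushforward_le \<eta>)

lemma F_gd_step_le:
  assumes A: "A \<in> spd_matrices" and \<eta>: "0 \<le> \<eta>" "\<eta> \<le> 1"
  shows "F (gd_step P \<eta> A) \<le> F A - \<eta> * (1 - \<eta> / 2) * grad_sq A"
proof -
  let ?G = "mean_transport A"
  let ?S = "(1 - \<eta>) *\<^sub>R mat 1 + \<eta> *\<^sub>R ?G"
  have S1: "?S - mat 1 = \<eta> *\<^sub>R (?G - mat 1)" by (simp add: algebra_simps)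
  have "F (?S ** A ** ?S) \<le> F A - (?S - mat 1) \<bullet> ((?G - mat 1) ** A)
    + 1 / 2 * ((?S - mat 1) \<bullet> ((?S - mat 1) ** A))"
    by (intro F_step_le A convex_step_spd mean_transport_spd \<eta>)
  also have "\<dots> = F A - \<eta> * (1 - \<eta> / 2) * grad_sq A"
  proof -
    have "F A - (\<eta> *\<^sub>R D) \<bullet> (D ** A) + 1 / 2 * ((\<eta> *\<^sub>R D) \<bullet> ((\<eta> *\<^sub>R D) ** A))
      = F A - \<eta> * (1 - \<eta> / 2) * (D \<bullet> (D ** A))" for D :: "real^'n^'n"
      by (simp add: matrix_mul_scaleR_left algebra_simps)
    then show ?thesis unfolding S1 grad_sq_def .
  qed
  finally show ?thesis by (simp add: gd_step_eq Let_def)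
qed

lemma gd_step_spd:
  assumes A: "A \<in> spd_matrices" and \<eta>: "0 \<le> \<eta>" "\<eta> \<le> 1"
  shows "gd_step P \<eta> A \<in> spd_matrices"
  unfolding gd_step_eq Let_def
  by (intro spd_congruence_spd A convex_step_spd mean_transport_spd \<eta>)

section \<open>First-order optimality\<close>

lemma barycenter_le: "is_barycenter P A \<Longrightarrow> B \<in> spd_matrices \<Longrightarrow> F A \<le> F B"
  unfolding is_barycenter_def is_arg_min_linorder by blast

lemma barycenter_spd: "is_barycenter P A \<Longrightarrow> A \<in> spd_matrices"
  unfolding is_barycenter_def is_arg_min_def by blast

text \<open>The gradient vanishes at the barycenter, since otherwise a full gradient step would decrease the
  functional.\<close>

lemma barycenter_mean_transport:
  assumes bary: "is_barycenter P A" shows "mean_transport A = mat 1"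
proof -
  have A: "A \<in> spd_matrices" by (rule barycenter_spd[OF bary])
  have "F A \<le> F (gd_step P 1 A)" by (intro barycenter_le[OF bary] gd_step_spd A) auto
  also have "\<dots> \<le> F A - 1 * (1 - 1 / 2) * grad_sq A" by (intro F_gd_step_le A) auto
  finally have g: "grad_sq A \<le> 0" by simp
  from spd_spectral_bounds[OF A] obtain a b where a: "0 < a" "eig_ge A a" by blast
  let ?D = "mean_transport A - mat 1"
  have "a * (?D \<bullet> ?D) \<le> 0" using weighted_inner_ge[OF spd_sym[OF A] a(2), of ?D] g
    by (simp add: grad_sq_def)
  then have "?D \<bullet> ?D \<le> 0" using a by (simp add: mult_le_0_iff)
  then have "?D = 0" using inner_ge_zero[of ?D] by (metis antisym inner_eq_zero_iff)
  then show ?thesis by simp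
qed

text \<open>Let \<open>v\<close> be a unit eigenvector for the largest eigenvalue \<open>\<mu>\<close>.  For almost every sample the
  quadratic form of the transport map at \<open>v\<close> is at most \<open>sqrt (lmax / \<mu>)\<close>, while the average value is one.\<close>

lemma barycenter_eig_le:
  assumes bary: "is_barycenter P A" shows "eig_le A lmax"
proof -
  have A: "A \<in> spd_matrices" by (rule barycenter_spd[OF bary])
  note sA = spd_sym[OF A]
  from max_eigenvector[OF sA] obtain v \<mu> where
    v: "norm v = 1" "A *v v = \<mu> *\<^sub>R v" "\<And>x. x \<bullet> (A *v x) \<le> \<mu> * (x \<bullet> x)" by blast
  have vv: "v \<bullet> v = 1" "v \<noteq> 0" using v by (auto simp: dot_square_norm)
  have mu: "0 < \<mu>" using spd_pos[OF A vv(2)] v vv by simp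
  have "mean_transport A \<bullet> outer v v \<le> sqrt (lmax / \<mu>)"
  proof (rule mean_transport_inner_le[OF A])
    fix B assume B: "B \<in> spd_box"
    let ?t = "transport A B *v v"
    have "(\<mu> * (v \<bullet> ?t))\<^sup>2 = (v \<bullet> (A *v ?t))\<^sup>2"
      by (simp add: sym_dot[OF sA, of v] v)
    also have "\<dots> \<le> (v \<bullet> (A *v v)) * (?t \<bullet> (A *v ?t))" by (rule psd_cauchy_schwarz[OF spd_psd[OF A]])
    also have "\<dots> \<le> \<mu> * lmax"
    proof -
      have "?t \<bullet> (A *v ?t) \<le> lmax"
        using B congruence_quadratic_form[OF spd_sym[OF transport_spd[OF A box_spd[OF B]]], of v A]
        by (simp add: transport_pushforward[OF A box_spd[OF B]] spectral_box_def eig_le_def)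
          (metis mult.right_neutral vv(1))
      then show ?thesis using mu by (simp add: v vv)
    qed
    finally have "(v \<bullet> ?t)\<^sup>2 \<le> lmax / \<mu>" using mu by (simp add: power2_eq_square field_simps)
    then show "transport A B \<bullet> outer v v \<le> sqrt (lmax / \<mu>)"
      unfolding inner_outer by (rule real_le_rsqrt)
  qed
  then have "1 \<le> sqrt (lmax / \<mu>)" by (simp add: inner_outer barycenter_mean_transport[OF bary] vv)
  then have "\<mu> \<le> lmax" using mu by simp
  then show ?thesis using v(3) eig_le_mono[of A \<mu> lmax] by (simp add: eig_le_def)
qed

lemma variance_inequality:
  assumes bary: "is_barycenter P A" and B: "B \<in> spd_matrices"
  shows "1 / (2 * sqrt \<kappa>) * W2_sq B A \<le> F B - F A"
  using F_duality[OF B barycenter_spd[OF bary] barycenter_eig_le[OF bary]]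
  by (simp add: barycenter_mean_transport[OF bary])

lemma bw_variance_eq:
  assumes bary: "is_barycenter P A" shows "bw_variance P = 2 * F A"
proof -
  let ?A = "arg_min F (\<lambda>B. B \<in> spd_matrices)"
  have "is_arg_min F (\<lambda>B. B \<in> spd_matrices) ?A"
    using bary unfolding is_barycenter_def arg_min_def by (rule someI)
  then have "is_barycenter P ?A" by (simp add: is_barycenter_def)
  then have "F ?A = F A" using bary by (intro antisym barycenter_le barycenter_spd)
  then show ?thesis by (simp add: bw_variance_def)
qed

section \<open>Gradient descent\<close>

lemma gd_iterate_box:
  assumes "A0 \<in> spd_box" "0 \<le> \<eta>" "\<eta> \<le> 1 / 2" shows "gd_iterate P \<eta> A0 t \<in> spd_box"
proof (induction t)
  case (Suc t)
  then show ?case using gd_step_box[OF Suc assms(2,3)] by simp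
qed (simp add: assms)

text \<open>Descent by \<open>\<eta> * (1 - \<eta> / 2) * grad_sq A\<close>, where the coefficient is at least \<open>3 / (8 * \<kappa>)\<close> for
  \<open>\<eta> = 1 / (2 * \<kappa>)\<close>, combined with gradient domination.\<close>

lemma gd_rate:
  assumes bary: "is_barycenter P A'" and A: "A \<in> spd_box"
  shows "F (gd_step P (1 / (2 * \<kappa>)) A) - F A' \<le> exp (- 3 / (64 * \<kappa> powr (5 / 2))) * (F A - F A')"
proof -
  let ?\<eta> = "1 / (2 * \<kappa>)"
  note A' = barycenter_spd[OF bary]
  have Aspd: "A \<in> spd_matrices" by (rule box_spd[OF A])
  have k: "1 \<le> \<kappa>" "0 < sqrt \<kappa>" using \<kappa>_ge_1 by auto
  let ?K = "\<kappa> * sqrt \<kappa>"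
  have powr: "\<kappa> powr (5 / 2) = \<kappa> * ?K"
  proof -
    have "\<kappa> powr (5 / 2) = \<kappa> powr (2 + 1 / 2)" by simp
    also have "\<dots> = \<kappa>\<^sup>2 * sqrt \<kappa>" using k by (simp only: powr_add powr_half_sqrt) simp
    finally show ?thesis by (simp add: power2_eq_square)
  qed
  have gap: "0 \<le> F A - F A'" using barycenter_le[OF bary Aspd] by simp
  have pl: "F A - F A' \<le> ?K / 2 * grad_sq A"
    by (rule F_gradient_domination[OF A A' barycenter_eig_le[OF bary]])
  have coef: "3 / (8 * \<kappa>) \<le> ?\<eta> * (1 - ?\<eta> / 2)" using k by (simp add: field_simps)
  have "3 / (64 * \<kappa> powr (5 / 2)) * (F A - F A') \<le> 3 / (64 * \<kappa> powr (5 / 2)) * (?K / 2 * grad_sq A)"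
    using pl k by (intro mult_left_mono) auto
  also have "\<dots> = 3 / (128 * \<kappa>) * grad_sq A" using k unfolding powr by (simp add: field_simps)
  also have "\<dots> \<le> ?\<eta> * (1 - ?\<eta> / 2) * grad_sq A"
  proof (rule mult_right_mono[OF order_trans[OF _ coef] grad_sq_nonneg[OF Aspd]])
    show "3 / (128 * \<kappa>) \<le> 3 / (8 * \<kappa>)" using k by (simp add: field_simps)
  qed
  also have "\<dots> \<le> F A - F (gd_step P ?\<eta> A)"
    using F_gd_step_le[OF Aspd, of ?\<eta>] k by simp
  finally have "F (gd_step P ?\<eta> A) - F A' \<le> (1 + - 3 / (64 * \<kappa> powr (5 / 2))) * (F A - F A')"
    by (simp add: algebra_simps)
  also have "\<dots> \<le> exp (- 3 / (64 * \<kappa> powr (5 / 2))) * (F A - F A')"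
    by (rule mult_right_mono[OF exp_ge_add_one_self gap])
  finally show ?thesis .
qed

lemma gd_convergence:
  assumes bary: "is_barycenter P A'" and A0: "A0 \<in> spd_box"
  shows "F (gd_iterate P (1 / (2 * \<kappa>)) A0 T) - F A'
    \<le> exp (- (3 * real T) / (64 * \<kappa> powr (5 / 2))) * (F A0 - F A')"
proof (induction T)
  case (Suc T)
  let ?r = "\<lambda>n. exp (- (3 * real n) / (64 * \<kappa> powr (5 / 2)))"
  have "gd_iterate P (1 / (2 * \<kappa>)) A0 T \<in> spd_box" using \<kappa>_ge_1 by (intro gd_iterate_box A0) auto
  from gd_rate[OF bary this]
  have "F (gd_iterate P (1 / (2 * \<kappa>)) A0 (Suc T)) - F A'
      \<le> ?r 1 * (F (gd_iterate P (1 / (2 * \<kappa>)) A0 T) - F A')" by simp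
  also have "\<dots> \<le> ?r 1 * (?r T * (F A0 - F A'))" by (intro mult_left_mono Suc.IH) simp
  also have "\<dots> = ?r (Suc T) * (F A0 - F A')"
  proof -
    have "- (3 * real 1) / d + - (3 * real T) / d = - (3 * real (Suc T)) / d" for d :: real
      by (simp add: diff_divide_distrib)
    then have "?r 1 * ?r T = ?r (Suc T)" by (simp only: exp_add[symmetric])
    then show ?thesis by (simp only: mult.assoc[symmetric])
  qed
  finally show ?case .
qed simp

section \<open>Stochastic gradient descent\<close>

lemma measurable_F:
  assumes f: "f \<in> measurable M borel_spd" shows "(\<lambda>x. F (f x)) \<in> borel_measurable M"
proof -
  have "(\<lambda>z. W2_sq (f (fst z)) (snd z)) \<in> borel_measurable (M \<Otimes>\<^sub>M P)"
    by (intro measurable_W2_sq measurable_compose[OF measurable_fst f]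
        measurable_compose[OF measurable_snd measurable_ident_P])
  then have "(\<lambda>x. \<integral>B. W2_sq (f x) B \<partial>P) \<in> borel_measurable M"
    by (intro borel_measurable_lebesgue_integral) (simp add: split_def)
  then show ?thesis by (simp add: barycenter_functional_def)
qed

lemma sgd_step_spd:
  assumes "A \<in> spd_matrices" "B \<in> spd_matrices" "0 \<le> \<eta>" "\<eta> \<le> 1"
  shows "sgd_step \<eta> B A \<in> (spd_matrices :: (real^'n^'n) set)"
  unfolding sgd_step_def Let_def
  by (intro spd_congruence_spd convex_step_spd transport_spd assms)

lemma measurable_sgd_step:
  assumes f: "f \<in> measurable M borel_spd" and g: "g \<in> measurable M borel_spd"
    and \<eta>: "0 \<le> \<eta>" "\<eta> \<le> 1"
  shows "(\<lambda>x. sgd_step \<eta> (g x) (f x)) \<in> measurable M (borel_spd :: (real^'n^'n) measure)"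
proof (rule measurable_restrict_space2)
  show "(\<lambda>x. sgd_step \<eta> (g x) (f x)) \<in> space M \<rightarrow> spd_matrices"
    using measurable_space[OF f] measurable_space[OF g] \<eta>
    by (auto simp: space_restrict_space intro: sgd_step_spd)
  show "(\<lambda>x. sgd_step \<eta> (g x) (f x)) \<in> borel_measurable M"
    unfolding sgd_step_def Let_def using measurable_transport[OF f g] measurable_spd_borel[OF f]
    by (intro borel_measurable_matrix_mul borel_measurable_add borel_measurable_scaleR) auto
qed

lemma F_box_bound:
  assumes A: "A \<in> spd_box" shows "\<bar>F A\<bar> \<le> real CARD('n) * lmax"
proof -
  have Aspd: "A \<in> spd_matrices" "eig_le A lmax" using box_spd[OF A] A by (auto simp: spectral_box_def)
  have "(\<integral>B. W2_sq A B \<partial>P) \<le> (\<integral>B. 2 * (real CARD('n) * lmax) \<partial>P)"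
  proof (rule integral_mono_AE[OF integrable_W2_sq[OF Aspd(1)] integrable_const])
    show "AE B in P. W2_sq A B \<le> 2 * (real CARD('n) * lmax)"
      using AE_box
    proof eventually_elim
      case (elim B)
      have B: "B \<in> spd_matrices" "eig_le B lmax" using box_spd[OF elim] elim by (auto simp: spectral_box_def)
      have T: "transport A B \<in> spd_matrices" by (rule transport_spd[OF Aspd(1) B(1)])
      have "0 \<le> trace (transport A B ** A)"
        using psd_inner_nonneg[OF spd_psd[OF T] spd_psd[OF Aspd(1)]] spd_sym[OF T]
        by (simp add: inner_matrix_eq_trace)
      then show ?case
        using trace_le_of_eig_le[OF Aspd(2)] trace_le_of_eig_le[OF B(2)] W2_sq_transport[OF Aspd(1) B(1)]
        by linarith
    qed
  qed
  then have "F A \<le> real CARD('n) * lmax" by (simp add: integral_W2_sq prob_space)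
  then show ?thesis using F_nonneg[OF Aspd(1)] by simp
qed

lemma integrable_F:
  assumes M: "prob_space M" and f: "f \<in> measurable M borel_spd" and box: "AE x in M. f x \<in> spd_box"
  shows "integrable M (\<lambda>x. F (f x))"
proof -
  interpret M: prob_space M by (rule M)
  have "AE x in M. norm (F (f x)) \<le> real CARD('n) * lmax"
    using box by eventually_elim (simp add: F_box_bound)
  then show ?thesis using measurable_F[OF f] by (intro M.integrable_const_bound)
qed

lemma F_sgd_step_le:
  assumes A: "A \<in> spd_matrices" and B: "B \<in> spd_matrices" and \<eta>: "0 \<le> \<eta>" "\<eta> \<le> 1"
  shows "F (sgd_step \<eta> B A) \<le> F A - \<eta> * ((transport A B - mat 1) \<bullet> ((mean_transport A - mat 1) ** A))
    + \<eta>\<^sup>2 / 2 * W2_sq A B"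
proof -
  let ?T = "transport A B"
  let ?S = "(1 - \<eta>) *\<^sub>R mat 1 + \<eta> *\<^sub>R ?T"
  have S1: "?S - mat 1 = \<eta> *\<^sub>R (?T - mat 1)" by (simp add: algebra_simps)
  have "F (?S ** A ** ?S) \<le> F A - (?S - mat 1) \<bullet> ((mean_transport A - mat 1) ** A)
    + 1 / 2 * ((?S - mat 1) \<bullet> ((?S - mat 1) ** A))"
    by (intro F_step_le A convex_step_spd transport_spd B \<eta>)
  also have "\<dots> = F A - \<eta> * ((?T - mat 1) \<bullet> ((mean_transport A - mat 1) ** A)) + \<eta>\<^sup>2 / 2 * W2_sq A B"
  proof -
    have "F A - (\<eta> *\<^sub>R X) \<bullet> D + 1 / 2 * ((\<eta> *\<^sub>R X) \<bullet> ((\<eta> *\<^sub>R X) ** A))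
      = F A - \<eta> * (X \<bullet> D) + \<eta>\<^sup>2 / 2 * (X \<bullet> (X ** A))" for D X :: "real^'n^'n"
      by (simp add: matrix_mul_scaleR_left power2_eq_square)
    then show ?thesis unfolding S1 W2_sq_eq_weighted[OF A B] .
  qed
  finally show ?thesis by (simp add: sgd_step_def Let_def)
qed

lemma measurable_const_spd: "A \<in> spd_matrices \<Longrightarrow> (\<lambda>_. A) \<in> measurable M borel_spd"
  by (rule measurable_const) (simp add: space_restrict_space)

lemma sgd_conditional_decrease:
  assumes bary: "is_barycenter P A'" and A: "A \<in> spd_box" and \<eta>: "0 \<le> \<eta>" "\<eta> \<le> 1 / 2"
  shows "(\<integral>B. F (sgd_step \<eta> B A) \<partial>P) - F A'
    \<le> (1 - 2 * \<eta> / (\<kappa> * sqrt \<kappa>) + \<eta>\<^sup>2) * (F A - F A') + \<eta>\<^sup>2 * F A'"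
proof -
  have Aspd: "A \<in> spd_matrices" by (rule box_spd[OF A])
  let ?X = "(mean_transport A - mat 1) ** A"
  have int: "integrable P (\<lambda>B. transport A B \<bullet> ?X)"
    by (intro Bochner_Integration.integrable_inner_left integrable_transport Aspd)
  have "(\<integral>B. F (sgd_step \<eta> B A) \<partial>P)
    \<le> (\<integral>B. F A - \<eta> * (transport A B \<bullet> ?X - mat 1 \<bullet> ?X) + \<eta>\<^sup>2 / 2 * W2_sq A B \<partial>P)"
  proof (rule integral_mono)
    have "AE B in P. sgd_step \<eta> B A \<in> spd_box"
      using AE_box by eventually_elim (use sgd_step_box[OF A _ \<eta>] in blast)
    then show "integrable P (\<lambda>B. F (sgd_step \<eta> B A))"
      using \<eta> by (intro integrable_F prob_space_P measurable_sgd_step measurable_const_spd Aspd measurable_ident_P) auto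
    show "integrable P (\<lambda>B. F A - \<eta> * (transport A B \<bullet> ?X - mat 1 \<bullet> ?X) + \<eta>\<^sup>2 / 2 * W2_sq A B)"
      by (intro Bochner_Integration.integrable_add Bochner_Integration.integrable_diff
          Bochner_Integration.integrable_mult_right integrable_W2_sq Aspd int integrable_const)
    show "F (sgd_step \<eta> B A) \<le> F A - \<eta> * (transport A B \<bullet> ?X - mat 1 \<bullet> ?X) + \<eta>\<^sup>2 / 2 * W2_sq A B"
      if "B \<in> space P" for B
      using F_sgd_step_le[OF Aspd _ \<eta>(1), of B] that \<eta> unfolding inner_diff_left[of "transport A B"]
      by (simp add: space_P)
  qed
  also have "\<dots> = F A - \<eta> * (mean_transport A \<bullet> ?X - mat 1 \<bullet> ?X) + \<eta>\<^sup>2 / 2 * (2 * F A)"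
    using integrable_W2_sq[OF Aspd] int
    by (simp add: mean_transport_inner[OF Aspd] prob_space integral_W2_sq)
  also have "mean_transport A \<bullet> ?X - mat 1 \<bullet> ?X = grad_sq A"
    unfolding grad_sq_def by (simp only: inner_diff_left)
  finally have le: "(\<integral>B. F (sgd_step \<eta> B A) \<partial>P) \<le> F A - \<eta> * grad_sq A + \<eta>\<^sup>2 * F A" by simp
  have k: "0 < \<kappa> * sqrt \<kappa>" using \<kappa>_ge_1 by simp
  have "F A - F A' \<le> \<kappa> * sqrt \<kappa> / 2 * grad_sq A"
    by (rule F_gradient_domination[OF A barycenter_spd[OF bary] barycenter_eig_le[OF bary]])
  then have "2 / (\<kappa> * sqrt \<kappa>) * (F A - F A') \<le> grad_sq A" using k by (simp add: field_simps)
  from mult_left_mono[OF this \<eta>(1)]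
  have "2 * \<eta> / (\<kappa> * sqrt \<kappa>) * (F A - F A') \<le> \<eta> * grad_sq A" by (simp add: mult_ac)
  moreover have "(1 - c + \<eta>\<^sup>2) * (a - b) + \<eta>\<^sup>2 * b = a - c * (a - b) + \<eta>\<^sup>2 * a - b" for a b c :: real
    by (simp add: algebra_simps)
  ultimately show ?thesis using le by simp
qed

text \<open>A step of size one from the barycenter towards a sample lands on the sample; the linear term of the
  quadratic bound vanishes there, and the quadratic term averages to the optimal value.\<close>

lemma F_sample_mean_le:
  assumes bary: "is_barycenter P A'"
  shows "(\<integral>B. F B \<partial>P) \<le> 2 * F A'"
proof -
  note A' = barycenter_spd[OF bary]
  have "(\<integral>B. F B \<partial>P) \<le> (\<integral>B. F A' + 1 / 2 * W2_sq A' B \<partial>P)"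
  proof (rule integral_mono)
    show "integrable P F" using integrable_F[OF prob_space_P measurable_ident_P AE_box] .
    show "integrable P (\<lambda>B. F A' + 1 / 2 * W2_sq A' B)"
      by (intro Bochner_Integration.integrable_add
          Bochner_Integration.integrable_mult_right integrable_W2_sq A' integrable_const)
    show "F B \<le> F A' + 1 / 2 * W2_sq A' B" if "B \<in> space P" for B
      using F_sgd_step_le[OF A', of B 1] that barycenter_mean_transport[OF bary] transport_pushforward[OF A', of B]
      by (simp add: space_P sgd_step_def)
  qed
  also have "\<dots> = 2 * F A'"
    using integrable_W2_sq[OF A'] by (simp add: prob_space integral_W2_sq)
  finally show ?thesis .
qed

text \<open>The new sample is independent of the current iterate, so averaging over it first is
  legitimate.\<close>

lemma sgd_expected_decrease:
  fixes M :: "'w measure"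
  assumes bary: "is_barycenter P A'" and M: "prob_space M"
    and ind: "prob_space.indep_var M borel_spd X P K" and K: "distr M P K = P"
    and box: "AE \<omega> in M. X \<omega> \<in> spd_box" and \<eta>: "0 \<le> \<eta>" "\<eta> \<le> 1 / 2"
  shows "(\<integral>\<omega>. F (sgd_step \<eta> (K \<omega>) (X \<omega>)) \<partial>M) - F A'
    \<le> (1 - 2 * \<eta> / (\<kappa> * sqrt \<kappa>) + \<eta>\<^sup>2) * ((\<integral>\<omega>. F (X \<omega>) \<partial>M) - F A') + \<eta>\<^sup>2 * F A'"
proof -
  interpret M: prob_space M by (rule M)
  have X: "X \<in> measurable M borel_spd" and Km: "K \<in> measurable M P"
    using ind by (auto dest: M.indep_var_rv1 M.indep_var_rv2)
  have Km': "K \<in> measurable M borel_spd" using Km by (simp add: measurable_P_iff)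
  let ?D = "distr M borel_spd X"
  interpret D: prob_space ?D by (rule M.prob_space_distr[OF X])
  interpret DP: pair_prob_space ?D P ..
  have joint: "?D \<Otimes>\<^sub>M P = distr M (borel_spd \<Otimes>\<^sub>M P) (\<lambda>\<omega>. (X \<omega>, K \<omega>))"
    using ind unfolding M.indep_var_distribution_eq K by simp
  have XK: "(\<lambda>\<omega>. (X \<omega>, K \<omega>)) \<in> measurable M (borel_spd \<Otimes>\<^sub>M P)" using X Km by simp
  let ?g = "\<lambda>z. F (sgd_step \<eta> (snd z) (fst z))"
  have g: "?g \<in> borel_measurable (borel_spd \<Otimes>\<^sub>M P)"
    using \<eta> by (intro measurable_F measurable_sgd_step measurable_fst
        measurable_compose[OF measurable_snd measurable_ident_P]) auto
  have boxD: "AE A in ?D. A \<in> spd_box"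
  proof (subst AE_distr_iff[OF X])
    have "(\<lambda>A. A) \<in> borel_measurable (borel_spd :: (real^'n^'n) measure)"
      by (rule measurable_restrict_space1) simp
    from measurable_sets[OF this borel_closed[OF closed_spectral_box], of lmin lmax]
    show "{A \<in> space borel_spd. A \<in> spd_box} \<in> sets borel_spd"
      by (simp add: Int_def vimage_def conj_commute)
  qed (rule box)
  have boxK: "AE \<omega> in M. K \<omega> \<in> spd_box"
    by (rule AE_distrD[OF Km], unfold K, rule AE_box)
  have "AE \<omega> in M. sgd_step \<eta> (K \<omega>) (X \<omega>) \<in> spd_box"
    using box boxK by eventually_elim (use sgd_step_box \<eta> in blast)
  then have "integrable M (\<lambda>\<omega>. F (sgd_step \<eta> (K \<omega>) (X \<omega>)))"
    using \<eta> by (intro integrable_F M measurable_sgd_step X Km') auto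
  then have intg: "integrable (?D \<Otimes>\<^sub>M P) ?g"
    unfolding joint by (subst integrable_distr_eq[OF XK g]) simp
  have intF: "integrable ?D F"
    by (rule integrable_F[OF D.prob_space_axioms _ boxD]) simp
  have "(\<integral>\<omega>. F (sgd_step \<eta> (K \<omega>) (X \<omega>)) \<partial>M) = (\<integral>z. ?g z \<partial>(?D \<Otimes>\<^sub>M P))"
    unfolding joint by (subst integral_distr[OF XK g]) simp
  also have "\<dots> = (\<integral>A. (\<integral>B. F (sgd_step \<eta> B A) \<partial>P) \<partial>?D)"
    using DP.integral_fst'[OF intg] by simp
  also have "\<dots> \<le> (\<integral>A. (1 - 2 * \<eta> / (\<kappa> * sqrt \<kappa>) + \<eta>\<^sup>2) * (F A - F A') + \<eta>\<^sup>2 * F A' + F A' \<partial>?D)"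
  proof (rule integral_mono_AE)
    show "integrable ?D (\<lambda>A. \<integral>B. F (sgd_step \<eta> B A) \<partial>P)"
      using DP.integrable_fst'[OF intg] by simp
    show "integrable ?D (\<lambda>A. (1 - 2 * \<eta> / (\<kappa> * sqrt \<kappa>) + \<eta>\<^sup>2) * (F A - F A') + \<eta>\<^sup>2 * F A' + F A')"
      by (intro Bochner_Integration.integrable_add Bochner_Integration.integrable_diff
          Bochner_Integration.integrable_mult_right intF D.integrable_const)
    show "AE A in ?D. (\<integral>B. F (sgd_step \<eta> B A) \<partial>P)
        \<le> (1 - 2 * \<eta> / (\<kappa> * sqrt \<kappa>) + \<eta>\<^sup>2) * (F A - F A') + \<eta>\<^sup>2 * F A' + F A'"
      using boxD
    proof eventually_elim
      case (elim A)
      show ?case using sgd_conditional_decrease[OF bary elim \<eta>] by linarith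
    qed
  qed
  also have "\<dots> = (1 - 2 * \<eta> / (\<kappa> * sqrt \<kappa>) + \<eta>\<^sup>2) * ((\<integral>A. F A \<partial>?D) - F A') + \<eta>\<^sup>2 * F A' + F A'"
  proof -
    have "(\<integral>A. c * (F A - F A') + \<eta>\<^sup>2 * F A' + F A' \<partial>?D) = c * ((\<integral>A. F A \<partial>?D) - F A') + \<eta>\<^sup>2 * F A' + F A'" for c
      using intF by (simp add: D.prob_space[unfolded space_distr])
    then show ?thesis .
  qed
  also have "(\<integral>A. F A \<partial>?D) = (\<integral>\<omega>. F (X \<omega>) \<partial>M)"
    by (rule integral_distr[OF X measurable_F]) simp
  finally show ?thesis by simp
qed

lemma sgd_iterate_cong:
  "(\<And>s. s \<in> {1..t} \<Longrightarrow> K s = K' s) \<Longrightarrow> sgd_iterate \<eta> K A0 t = sgd_iterate \<eta> K' A0 t"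
  by (induction t) auto

lemma measurable_sgd_iterate:
  fixes M :: "'w measure"
  assumes A0: "A0 \<in> spd_matrices" and K: "\<And>s. s \<in> {1..t} \<Longrightarrow> K s \<in> measurable M P"
    and \<eta>: "\<And>s. s \<in> {1..t} \<Longrightarrow> 0 \<le> \<eta> s \<and> \<eta> s \<le> 1"
  shows "(\<lambda>\<omega>. sgd_iterate \<eta> (\<lambda>s. K s \<omega>) A0 t) \<in> measurable M borel_spd"
  using K \<eta>
proof (induction t)
  case 0
  then show ?case by (simp add: measurable_const_spd A0)
next
  case (Suc t)
  then have "(\<lambda>\<omega>. sgd_iterate \<eta> (\<lambda>s. K s \<omega>) A0 t) \<in> measurable M borel_spd" "K (Suc t) \<in> measurable M borel_spd"
    using Suc.prems(1)[of "Suc t"] by (auto simp: measurable_P_iff)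
  then show ?case using Suc.prems(2)[of "Suc t"] by (auto intro!: measurable_sgd_step)
qed

text \<open>A first step of size one jumps to the first sample, whose expected excess is at most the
  optimal value; from there on the step sizes decay like \<open>1 / t\<close>.\<close>

definition sgd_eta :: "nat \<Rightarrow> real" where
  "sgd_eta t = (if t \<le> 1 then 1 else 2 * (\<kappa> * sqrt \<kappa>) / (real t + 4 * \<kappa> ^ 3 - 1))"

lemma kappa_cube: "(\<kappa> * sqrt \<kappa>)\<^sup>2 = \<kappa> ^ 3" "1 \<le> \<kappa> * sqrt \<kappa>"
  using \<kappa>_ge_1 mult_mono[of 1 \<kappa> 1 "sqrt \<kappa>"] by (auto simp: power_mult_distrib power2_eq_square power3_eq_cube)

lemma sgd_eta_bounds:
  shows "0 < sgd_eta t" "sgd_eta t \<le> 1" "1 < t \<Longrightarrow> sgd_eta t \<le> 1 / 2"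
proof -
  define K where "K = \<kappa> * sqrt \<kappa>"
  have K: "1 \<le> K" "K\<^sup>2 = \<kappa> ^ 3" using kappa_cube by (auto simp: K_def)
  have "K \<le> K\<^sup>2" using K(1) by (simp add: power2_eq_square)
  then have d: "4 * K \<le> real t + 4 * \<kappa> ^ 3 - 1" if "1 < t" using that by (simp add: K(2))
  show half: "sgd_eta t \<le> 1 / 2" if "1 < t"
  proof -
    have "0 < real t + 4 * \<kappa> ^ 3 - 1" using d[OF that] K(1) by linarith
    then show ?thesis using d[OF that] that by (simp add: sgd_eta_def K_def[symmetric] field_simps)
  qed
  show "sgd_eta t \<le> 1" using half by (cases "1 < t") (auto simp: sgd_eta_def)
  show "0 < sgd_eta t"
  proof (cases "1 < t")
    case True
    have "0 < real t + 4 * \<kappa> ^ 3 - 1" using d[OF True] K(1) by linarith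
    then show ?thesis using True K(1) by (simp add: sgd_eta_def K_def[symmetric])
  qed (simp add: sgd_eta_def)
qed

text \<open>With \<open>n = t + 4 * \<kappa> ^ 3\<close> and \<open>c = 2 / \<kappa> powr (3 / 2)\<close> the step size is \<open>4 / (c * n)\<close>.  Half of the
  contraction \<open>c * \<eta> = 4 / n\<close> absorbs the \<open>\<eta>\<^sup>2\<close> in the factor of \<open>a\<close>; the other half pays for the
  noise \<open>\<eta>\<^sup>2 * V\<close> and for passing from \<open>n - 1\<close> to \<open>n\<close> in the denominator.\<close>

lemma sgd_rate_step:
  assumes t: "1 \<le> t" and V: "0 \<le> V" and a: "0 \<le> a" "a \<le> 4 * \<kappa> ^ 3 * V / (real t + 4 * \<kappa> ^ 3 - 1)"
  defines "\<eta> \<equiv> sgd_eta (Suc t)"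
  shows "(1 - 2 * \<eta> / (\<kappa> * sqrt \<kappa>) + \<eta>\<^sup>2) * a + \<eta>\<^sup>2 * V \<le> 4 * \<kappa> ^ 3 * V / (real (Suc t) + 4 * \<kappa> ^ 3 - 1)"
proof -
  define K where "K = \<kappa> * sqrt \<kappa>"
  have K: "1 \<le> K" "\<kappa> ^ 3 = K\<^sup>2" using kappa_cube by (auto simp: K_def)
  define n where "n = real t + 4 * K\<^sup>2"
  have n: "1 + 4 * K\<^sup>2 \<le> n" using t by (simp add: n_def)
  have K2: "1 \<le> K\<^sup>2" using K by simp
  have n1: "1 < n" "0 < n - 1" using n K2 by auto
  have eta: "\<eta> = 2 * K / n" using t by (simp add: \<eta>_def sgd_eta_def K K_def[symmetric] n_def)
  have a': "a \<le> 4 * K\<^sup>2 * V / (n - 1)" using a(2) by (simp add: K n_def)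
  have contraction: "1 - 2 * \<eta> / K + \<eta>\<^sup>2 \<le> 1 - 2 / n"
  proof -
    have "\<eta>\<^sup>2 = 4 * K\<^sup>2 / n / n" by (simp add: eta power2_eq_square)
    also have "\<dots> \<le> 2 / n" using n n1 by (simp add: field_simps)
    finally have "\<eta>\<^sup>2 \<le> 2 / n" .
    moreover have "2 * \<eta> / K = 4 / n" using K n1 by (simp add: eta)
    ultimately show ?thesis by simp
  qed
  have pos: "0 \<le> 1 - 2 / n" using n K2 by (simp add: field_simps)
  have "(1 - 2 * \<eta> / K + \<eta>\<^sup>2) * a + \<eta>\<^sup>2 * V \<le> (1 - 2 / n) * a + \<eta>\<^sup>2 * V"
    using mult_right_mono[OF contraction a(1)] by simp
  also have "\<dots> \<le> (1 - 2 / n) * (4 * K\<^sup>2 * V / (n - 1)) + \<eta>\<^sup>2 * V"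
    using mult_left_mono[OF a' pos] by simp
  also have "\<dots> = 4 * K\<^sup>2 * V * ((1 - 2 / n) / (n - 1) + 1 / n\<^sup>2)"
    by (simp add: eta power_divide power_mult_distrib distrib_left mult_ac)
  also have "\<dots> \<le> 4 * K\<^sup>2 * V * (1 / n)"
  proof (rule mult_left_mono)
    have "(1 - 2 / n) / (n - 1) + 1 / n\<^sup>2 \<le> (1 - 2 / n) / (n - 1) + 1 / (n * (n - 1))"
      using n1 by (simp add: power2_eq_square frac_le)
    also have "\<dots> = 1 / n" using n1 by (simp add: field_simps)
    finally show "(1 - 2 / n) / (n - 1) + 1 / n\<^sup>2 \<le> 1 / n" .
  qed (simp add: V)
  finally show ?thesis by (simp add: K K_def[symmetric] n_def)
qed

lemma sgd_convergence:
  fixes M :: "'w measure"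
  assumes bary: "is_barycenter P A'" and A0: "A0 \<in> spd_box"
    and iid: "iid_samples M P {1..T} K" and T: "1 \<le> T"
  defines "X \<equiv> \<lambda>t \<omega>. sgd_iterate sgd_eta (\<lambda>s. K s \<omega>) A0 t"
  shows "X T \<in> measurable M borel_spd" "AE \<omega> in M. X T \<omega> \<in> spd_box"
    "(\<integral>\<omega>. F (X T \<omega>) \<partial>M) - F A' \<le> 4 * \<kappa> ^ 3 * F A' / (real T + 4 * \<kappa> ^ 3 - 1)"
proof -
  have M: "prob_space M" and KP: "\<And>t. t \<in> {1..T} \<Longrightarrow> distr M P (K t) = P"
    using iid by (auto simp: iid_samples_def)
  interpret M: prob_space M by (rule M)
  have ind: "M.indep_vars (\<lambda>_. P) K {1..T}" using iid by (simp add: iid_samples_def)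
  have Km: "K t \<in> measurable M P" if "t \<in> {1..T}" for t
    using ind that unfolding M.indep_vars_def2 by auto
  have A0spd: "A0 \<in> spd_matrices" by (rule box_spd[OF A0])
  note eta = sgd_eta_bounds
  have Xm: "X t \<in> measurable M borel_spd" if "t \<le> T" for t
    unfolding X_def using that eta
    by (intro measurable_sgd_iterate A0spd Km) (auto simp: less_imp_le)
  have boxK: "AE \<omega> in M. K t \<omega> \<in> spd_box" if "t \<in> {1..T}" for t
    by (rule AE_distrD[OF Km[OF that]], unfold KP[OF that], rule AE_box)
  have X1: "X (Suc 0) \<omega> = K (Suc 0) \<omega>" if "\<omega> \<in> space M" for \<omega>
    using transport_pushforward[OF A0spd, of "K 1 \<omega>"] measurable_space[OF Km, of 1 \<omega>] that T
    by (simp add: X_def sgd_step_def sgd_eta_def space_P)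
  have Xbox: "AE \<omega> in M. X t \<omega> \<in> spd_box" if "1 \<le> t" "t \<le> T" for t
    using that
  proof (induction t rule: dec_induct)
    case base
    have "AE \<omega> in M. K 1 \<omega> \<in> spd_box" using T by (intro boxK) auto
    with AE_space show ?case by eventually_elim (simp add: X1)
  next
    case (step t)
    then have "AE \<omega> in M. X t \<omega> \<in> spd_box" by simp
    moreover have "AE \<omega> in M. K (Suc t) \<omega> \<in> spd_box" using step by (intro boxK) auto
    ultimately show ?case
    proof eventually_elim
      case (elim \<omega>)
      then show ?case using sgd_step_box[OF elim, of "sgd_eta (Suc t)"] eta(1)[of "Suc t"] eta(3)[of "Suc t"] step
        by (simp add: X_def less_imp_le)
    qed
  qed
  have rate: "(\<integral>\<omega>. F (X t \<omega>) \<partial>M) - F A' \<le> 4 * \<kappa> ^ 3 * F A' / (real t + 4 * \<kappa> ^ 3 - 1)"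
    if "1 \<le> t" "t \<le> T" for t
    using that
  proof (induction t rule: dec_induct)
    case base
    have K1: "1 \<in> {1..T}" using T by simp
    have "(\<integral>\<omega>. F (X 1 \<omega>) \<partial>M) = (\<integral>\<omega>. F (K 1 \<omega>) \<partial>M)"
      by (rule Bochner_Integration.integral_cong[OF refl]) (simp add: X1)
    also have "\<dots> = (\<integral>B. F B \<partial>distr M P (K 1))"
      by (rule integral_distr[OF Km[OF K1], symmetric]) (rule measurable_F[OF measurable_ident_P])
    also have "\<dots> \<le> 2 * F A'" unfolding KP[OF K1] by (rule F_sample_mean_le[OF bary])
    finally show ?case using \<kappa>_ge_1 by simp
  next
    case (step t)
    have t: "Suc t \<in> {1..T}" using step by auto
    let ?\<eta> = "sgd_eta (Suc t)"
    have ind_step: "M.indep_var borel_spd (X t) P (K (Suc t))"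
    proof -
      have "M.indep_var (PiM {1..t} (\<lambda>_. P)) (\<lambda>\<omega>. restrict (\<lambda>i. K i \<omega>) {1..t})
        (PiM {Suc t} (\<lambda>_. P)) (\<lambda>\<omega>. restrict (\<lambda>i. K i \<omega>) {Suc t})"
        using t by (intro M.indep_var_restrict[OF ind]) auto
      moreover have "(\<lambda>k. sgd_iterate sgd_eta k A0 t) \<in> measurable (PiM {1..t} (\<lambda>_. P)) borel_spd"
        using measurable_sgd_iterate[OF A0spd, of t "\<lambda>s k. k s" "PiM {1..t} (\<lambda>_. P)" sgd_eta] eta
        by (simp add: less_imp_le)
      moreover have "(\<lambda>k. k (Suc t)) \<in> measurable (PiM {Suc t} (\<lambda>_. P)) P" by simp
      ultimately have "M.indep_var borel_spd ((\<lambda>k. sgd_iterate sgd_eta k A0 t) \<circ> (\<lambda>\<omega>. restrict (\<lambda>i. K i \<omega>) {1..t}))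
        P ((\<lambda>k. k (Suc t)) \<circ> (\<lambda>\<omega>. restrict (\<lambda>i. K i \<omega>) {Suc t}))"
        by (rule M.indep_var_compose)
      moreover have "(\<lambda>k. sgd_iterate sgd_eta k A0 t) \<circ> (\<lambda>\<omega>. restrict (\<lambda>i. K i \<omega>) {1..t}) = X t"
        unfolding X_def o_def by (intro ext sgd_iterate_cong) simp
      moreover have "(\<lambda>k. k (Suc t)) \<circ> (\<lambda>\<omega>. restrict (\<lambda>i. K i \<omega>) {Suc t}) = K (Suc t)" by auto
      ultimately show ?thesis by simp
    qed
    have "AE \<omega> in M. X t \<omega> \<in> spd_box" using step by (intro Xbox) auto
    have gap: "0 \<le> (\<integral>\<omega>. F (X t \<omega>) \<partial>M) - F A'"
    proof -
      have "(\<integral>\<omega>. F A' \<partial>M) \<le> (\<integral>\<omega>. F (X t \<omega>) \<partial>M)"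
      proof (rule integral_mono[OF M.integrable_const])
        show "integrable M (\<lambda>\<omega>. F (X t \<omega>))" using step by (intro integrable_F M Xm Xbox) auto
        show "F A' \<le> F (X t \<omega>)" if "\<omega> \<in> space M" for \<omega>
          using measurable_space[OF Xm that, of t] step
          by (intro barycenter_le[OF bary]) (simp add: space_restrict_space)
      qed
      then show ?thesis by (simp add: M.prob_space)
    qed
    have "(\<integral>\<omega>. F (X (Suc t) \<omega>) \<partial>M) - F A' \<le> (1 - 2 * ?\<eta> / (\<kappa> * sqrt \<kappa>) + ?\<eta>\<^sup>2) * ((\<integral>\<omega>. F (X t \<omega>) \<partial>M) - F A') + ?\<eta>\<^sup>2 * F A'"
      using sgd_expected_decrease[OF bary M ind_step KP[OF t] \<open>AE \<omega> in M. X t \<omega> \<in> spd_box\<close>, of ?\<eta>]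
        eta(1)[of "Suc t"] eta(3)[of "Suc t"] step by (simp add: X_def less_imp_le)
    also have "\<dots> \<le> 4 * \<kappa> ^ 3 * F A' / (real (Suc t) + 4 * \<kappa> ^ 3 - 1)"
      using step by (intro sgd_rate_step F_nonneg barycenter_spd[OF bary] gap) auto
    finally show ?case .
  qed
  show "X T \<in> measurable M borel_spd" by (rule Xm) simp
  show "AE \<omega> in M. X T \<omega> \<in> spd_box" by (rule Xbox) (use T in simp_all)
  show "(\<integral>\<omega>. F (X T \<omega>) \<partial>M) - F A' \<le> 4 * \<kappa> ^ 3 * F A' / (real T + 4 * \<kappa> ^ 3 - 1)"
    by (rule rate) (use T in simp_all)
qed

text \<open>The pointwise variance inequality also bounds \<open>W2_sq\<close> by an integrable function.\<close>

lemma expected_variance_inequality: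
  fixes M :: "'w measure"
  assumes bary: "is_barycenter P A'" and M: "prob_space M"
    and X: "X \<in> measurable M borel_spd" and box: "AE \<omega> in M. X \<omega> \<in> spd_box"
  shows "integrable M (\<lambda>\<omega>. W2_sq (X \<omega>) A')"
    "1 / (2 * sqrt \<kappa>) * (\<integral>\<omega>. W2_sq (X \<omega>) A' \<partial>M) \<le> (\<integral>\<omega>. F (X \<omega>) \<partial>M) - F A'"
proof -
  interpret M: prob_space M by (rule M)
  note A' = barycenter_spd[OF bary]
  have spd: "X \<omega> \<in> spd_matrices" if "\<omega> \<in> space M" for \<omega>
    using measurable_space[OF X that] by (simp add: space_restrict_space)
  have intF: "integrable M (\<lambda>\<omega>. F (X \<omega>))" by (rule integrable_F[OF M X box])
  have le: "1 / (2 * sqrt \<kappa>) * W2_sq (X \<omega>) A' \<le> F (X \<omega>) - F A'" if "\<omega> \<in> space M" for \<omega>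
    by (rule variance_inequality[OF bary spd[OF that]])
  have k: "0 < 2 * sqrt \<kappa>" using \<kappa>_ge_1 by simp
  show int: "integrable M (\<lambda>\<omega>. W2_sq (X \<omega>) A')"
  proof (rule Bochner_Integration.integrable_bound)
    show "integrable M (\<lambda>\<omega>. 2 * sqrt \<kappa> * (F (X \<omega>) - F A'))"
      by (intro Bochner_Integration.integrable_mult_right Bochner_Integration.integrable_diff intF M.integrable_const)
    show "(\<lambda>\<omega>. W2_sq (X \<omega>) A') \<in> borel_measurable M"
      by (rule measurable_W2_sq[OF X measurable_const_spd[OF A']])
    show "AE \<omega> in M. norm (W2_sq (X \<omega>) A') \<le> norm (2 * sqrt \<kappa> * (F (X \<omega>) - F A'))"
    proof (rule AE_I2)
      fix \<omega> assume w: "\<omega> \<in> space M"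
      have "W2_sq (X \<omega>) A' \<le> 2 * sqrt \<kappa> * (F (X \<omega>) - F A')" using le[OF w] k by (simp add: field_simps)
      then show "norm (W2_sq (X \<omega>) A') \<le> norm (2 * sqrt \<kappa> * (F (X \<omega>) - F A'))"
        using W2_sq_nonneg[OF spd[OF w] A'] by simp
    qed
  qed
  have "(\<integral>\<omega>. 1 / (2 * sqrt \<kappa>) * W2_sq (X \<omega>) A' \<partial>M) \<le> (\<integral>\<omega>. F (X \<omega>) - F A' \<partial>M)"
    using int intF le by (intro integral_mono Bochner_Integration.integrable_mult_right
        Bochner_Integration.integrable_diff M.integrable_const)
  then show "1 / (2 * sqrt \<kappa>) * (\<integral>\<omega>. W2_sq (X \<omega>) A' \<partial>M) \<le> (\<integral>\<omega>. F (X \<omega>) \<partial>M) - F A'"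
    using int intF by (simp add: M.prob_space)
qed

end

theorem theorem2:
  fixes P :: "(real^'d^'d) measure"
    and lmin lmax \<kappa> :: real
    and \<Sigma>star \<Sigma>0 :: "real^'d^'d"
  assumes P: "spd_prob P"
    and bounds: "0 < lmin" "lmin \<le> lmax"
    and eigenvalues: "AE \<Sigma> in P. \<forall>l. is_eigenvalue \<Sigma> l \<longrightarrow> lmin \<le> l \<and> l \<le> lmax"
    and \<kappa>: "\<kappa> = lmax / lmin"
    and barycenter: "is_barycenter P \<Sigma>star"
    and init: "\<Sigma>0 \<in> measure_support P"
  shows
    "(\<forall>T::nat.
        let \<Sigma>T = gd_iterate P (1 / (2 * \<kappa>)) \<Sigma>0 T; F = barycenter_functional P
        in 1 / (2 * sqrt \<kappa>) * W2_sq \<Sigma>T \<Sigma>star \<le> F \<Sigma>T - F \<Sigma>star \<and>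
           F \<Sigma>T - F \<Sigma>star
             \<le> exp (- (3 * real T) / (64 * \<kappa> powr (5 / 2))) * (F \<Sigma>0 - F \<Sigma>star)) \<and>
     (\<forall>T::nat. 1 \<le> T \<longrightarrow>
        (\<exists>\<eta> :: nat \<Rightarrow> real.
           (\<forall>t\<in>{1..T}. 0 < \<eta> t \<and> \<eta> t \<le> 1) \<and>
           (\<forall>(M :: 'w measure) (K :: nat \<Rightarrow> 'w \<Rightarrow> real^'d^'d).
              iid_samples M P {1..T} K \<longrightarrow>
              (let \<Sigma>T = (\<lambda>\<omega>. sgd_iterate \<eta> (\<lambda>t. K t \<omega>) \<Sigma>0 T); F = barycenter_functional P
               in integrable M (\<lambda>\<omega>. W2_sq (\<Sigma>T \<omega>) \<Sigma>star) \<and>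
                  integrable M (\<lambda>\<omega>. F (\<Sigma>T \<omega>)) \<and>
                  1 / (2 * sqrt \<kappa>) * (\<integral>\<omega>. W2_sq (\<Sigma>T \<omega>) \<Sigma>star \<partial>M)
                    \<le> (\<integral>\<omega>. F (\<Sigma>T \<omega>) \<partial>M) - F \<Sigma>star \<and>
                  (\<integral>\<omega>. F (\<Sigma>T \<omega>) \<partial>M) - F \<Sigma>star
                    \<le> 48 * \<kappa> ^ 3 * bw_variance P / real T))))"
proof -
  interpret bounded_spd_prob P lmin lmax \<kappa>
    using P bounds eigenvalues \<kappa> by unfold_locales
  have box0: "\<Sigma>0 \<in> spd_box" by (rule measure_support_box[OF init])
  show ?thesis
  proof (intro conjI allI impI)
    fix T :: nat
    have "gd_iterate P (1 / (2 * \<kappa>)) \<Sigma>0 T \<in> spd_matrices"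
      using \<kappa>_ge_1 by (intro box_spd gd_iterate_box box0) auto
    then show "let \<Sigma>T = gd_iterate P (1 / (2 * \<kappa>)) \<Sigma>0 T; F = barycenter_functional P
        in 1 / (2 * sqrt \<kappa>) * W2_sq \<Sigma>T \<Sigma>star \<le> F \<Sigma>T - F \<Sigma>star \<and>
           F \<Sigma>T - F \<Sigma>star \<le> exp (- (3 * real T) / (64 * \<kappa> powr (5 / 2))) * (F \<Sigma>0 - F \<Sigma>star)"
      unfolding Let_def using variance_inequality[OF barycenter] gd_convergence[OF barycenter box0] by blast
  next
    fix T :: nat assume T: "1 \<le> T"
    show "\<exists>\<eta> :: nat \<Rightarrow> real. (\<forall>t\<in>{1..T}. 0 < \<eta> t \<and> \<eta> t \<le> 1) \<and>
           (\<forall>(M :: 'w measure) (K :: nat \<Rightarrow> 'w \<Rightarrow> real^'d^'d).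
              iid_samples M P {1..T} K \<longrightarrow>
              (let \<Sigma>T = (\<lambda>\<omega>. sgd_iterate \<eta> (\<lambda>t. K t \<omega>) \<Sigma>0 T); F = barycenter_functional P
               in integrable M (\<lambda>\<omega>. W2_sq (\<Sigma>T \<omega>) \<Sigma>star) \<and>
                  integrable M (\<lambda>\<omega>. F (\<Sigma>T \<omega>)) \<and>
                  1 / (2 * sqrt \<kappa>) * (\<integral>\<omega>. W2_sq (\<Sigma>T \<omega>) \<Sigma>star \<partial>M)
                    \<le> (\<integral>\<omega>. F (\<Sigma>T \<omega>) \<partial>M) - F \<Sigma>star \<and>
                  (\<integral>\<omega>. F (\<Sigma>T \<omega>) \<partial>M) - F \<Sigma>star
                    \<le> 48 * \<kappa> ^ 3 * bw_variance P / real T))"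
      unfolding Let_def
    proof (intro exI[of _ sgd_eta] conjI ballI allI impI)
      show "0 < sgd_eta t" "sgd_eta t \<le> 1" for t by (rule sgd_eta_bounds)+
      fix M :: "'w measure" and K :: "nat \<Rightarrow> 'w \<Rightarrow> real^'d^'d"
      assume iid: "iid_samples M P {1..T} K"
      then have M: "prob_space M" by (simp add: iid_samples_def)
      let ?X = "\<lambda>\<omega>. sgd_iterate sgd_eta (\<lambda>t. K t \<omega>) \<Sigma>0 T"
      note conv = sgd_convergence[OF barycenter box0 iid T]
      note var = expected_variance_inequality[OF barycenter M conv(1,2)]
      show "integrable M (\<lambda>\<omega>. W2_sq (?X \<omega>) \<Sigma>star)" by (rule var(1))
      show "integrable M (\<lambda>\<omega>. F (?X \<omega>))" by (rule integrable_F[OF M conv(1,2)])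
      show "1 / (2 * sqrt \<kappa>) * (\<integral>\<omega>. W2_sq (?X \<omega>) \<Sigma>star \<partial>M) \<le> (\<integral>\<omega>. F (?X \<omega>) \<partial>M) - F \<Sigma>star"
        by (rule var(2))
      have V: "0 \<le> F \<Sigma>star" by (rule F_nonneg[OF barycenter_spd[OF barycenter]])
      have k3: "1 \<le> \<kappa> ^ 3" using \<kappa>_ge_1 by simp
      have "(\<integral>\<omega>. F (?X \<omega>) \<partial>M) - F \<Sigma>star \<le> 4 * \<kappa> ^ 3 * F \<Sigma>star / (real T + 4 * \<kappa> ^ 3 - 1)"
        by (rule conv(3))
      also have "\<dots> \<le> 96 * \<kappa> ^ 3 * F \<Sigma>star / real T"
      proof (rule frac_le)
        show "4 * \<kappa> ^ 3 * F \<Sigma>star \<le> 96 * \<kappa> ^ 3 * F \<Sigma>star" using \<kappa>_ge_1 V by (intro mult_right_mono) auto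
        show "real T \<le> real T + 4 * \<kappa> ^ 3 - 1" using k3 by linarith
      qed (use T \<kappa>_ge_1 V in auto)
      finally show "(\<integral>\<omega>. F (?X \<omega>) \<partial>M) - F \<Sigma>star \<le> 48 * \<kappa> ^ 3 * bw_variance P / real T"
        by (simp add: bw_variance_eq[OF barycenter] mult_ac)
    qed
  qed
qed

end
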